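(* Let $M$ be a smooth manifold, $\mathbb TM = TM\oplus T^*M$, and let $\mathcal G_0$ be the natural generalized metric on $\mathbb TM$. (i) For every generalized symplectic structure $\Omega\colon \Gamma(\mathbb TM)\times\Gamma(\mathbb TM)\to\mathfrak F(M)$ there is an injective endomorphism $\mathcal K\colon\Gamma(\mathbb TM)\to\Gamma(\mathbb TM)$ such that $$\Omega(X+\xi,Y+\eta)=\mathcal G_0(\mathcal K(X+\xi),Y+\eta)\qquad (\ast)$$ for all $X+\xi,\,Y+\eta\in\Gamma(\mathbb TM)$. In matrix notation $\mathcal K$ has the form $$\mathcal K=\begin{pmatrix}H&\sigma\\ \tau&-H^*\end{pmatrix},$$ where $H\colon\mathfrak X(M)\to\mathfrak X(M)$, $\sigma\colon\Lambda^1(M)\to\mathfrak X(M)$, $\tau\colon\mathfrak X(M)\to\Lambda^1(M)$ satisfy $(\tau X)(Y)=-(\tau Y)(X)$ and $\xi(\sigma\eta)=-\eta(\sigma\xi)$ for all $X,Y\in\mathfrak X(M)$ and $\xi,\eta\in\Lambda^1(M)$. (ii) Conversely, each injective endomorphism $\mathcal K$ of $\Gamma(\mathbb TM)$ of this matrix form, with $\tau$ and $\sigma$ satisfying these skew-symmetry conditions, induces a generalized symplectic structure $\Omega$ defined by $(\ast)$.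
   Context: $\mathfrak F(M)$ is the ring of smooth real functions on $M$; $\mathfrak X(M)$ and $\Lambda^1(M)$ are the $\mathfrak F(M)$-modules of vector fields and of 1-forms. Sections of $\mathbb TM=TM\oplus T^*M$ are written $X+\xi\in\Gamma(\mathbb TM)=\mathfrak X(M)\oplus\Lambda^1(M)$. All endomorphisms and component maps are $\mathfrak F(M)$-linear. A generalized symplectic structure is an $\mathfrak F(M)$-bilinear, skew-symmetric, nondegenerate map $\Omega\colon\Gamma(\mathbb TM)\times\Gamma(\mathbb TM)\to\mathfrak F(M)$ (no closedness is required), where nondegenerate means: if $\Omega(u,v)=0$ for all $v\in\Gamma(\mathbb TM)$, then $u=0$. The natural generalized metric is $\mathcal G_0(X+\xi,Y+\eta)=\frac12(\xi(Y)+\eta(X))$. Matrix notation: $\begin{pmatrix}H&\sigma\\ \tau&K\end{pmatrix}(X+\xi)=(HX+\sigma\xi)+(\tau X+K\xi)$. For $H\colon\mathfrak X(M)\to\mathfrak X(M)$, the dual $H^*\colon\Lambda^1(M)\to\Lambda^1(M)$ is $(H^*\xi)(X)=\xi(HX)$. *)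

theory Defs
  imports "HOL-Analysis.Analysis" "HOL-Library.Function_Algebras"
begin

text \<open>A manifold consists of a topological space, a model vector space and an atlas; a chart is a
  pair of an open domain and a coordinate map (only its values on the domain matter). A Euclidean
  type has positive dimension, so the model is allowed to be \<open>{0}\<close> in order to include
  zero-dimensional manifolds.\<close>

record ('m, 'e) manifold =
  mtop :: "'m topology"
  model :: "'e set"
  atlas :: "('m set \<times> ('m \<Rightarrow> 'e)) set"

text \<open>The set \<open>S\<close> is meant to be relatively open in the linear subspace \<open>V\<close>; for
  \<open>V = UNIV\<close> the filter \<open>at x within V\<close> is \<open>at x\<close>.\<close>

fun Ck_on :: "'e::euclidean_space set \<Rightarrow> nat \<Rightarrow> 'e set \<Rightarrow> ('e \<Rightarrow> 'f::real_normed_vector) \<Rightarrow> bool" where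
  "Ck_on V 0 S f \<longleftrightarrow> continuous_on S f"
| "Ck_on V (Suc k) S f \<longleftrightarrow>
     (\<forall>x\<in>S. f differentiable (at x within V)) \<and>
     (\<forall>v\<in>V. Ck_on V k S (\<lambda>x. frechet_derivative f (at x within V) v))"

definition smooth_on :: "'e::euclidean_space set \<Rightarrow> 'e set \<Rightarrow> ('e \<Rightarrow> 'f::real_normed_vector) \<Rightarrow> bool" where
  "smooth_on V S f \<longleftrightarrow> (\<forall>k. Ck_on V k S f)"

definition smooth_manifold :: "('m, 'e::euclidean_space) manifold \<Rightarrow> bool" where
  "smooth_manifold M \<longleftrightarrow>
     Hausdorff_space (mtop M) \<and> second_countable (mtop M) \<and>
     (model M = UNIV \<or> model M = {0}) \<and>
     topspace (mtop M) = (\<Union>(U, \<phi>)\<in>atlas M. U) \<and>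
     (\<forall>(U, \<phi>)\<in>atlas M.
        openin (mtop M) U \<and>
        openin (top_of_set (model M)) (\<phi> ` U) \<and>
        homeomorphic_map (subtopology (mtop M) U) (top_of_set (\<phi> ` U)) \<phi>) \<and>
     (\<forall>(U, \<phi>)\<in>atlas M. \<forall>(W, \<psi>)\<in>atlas M.
        smooth_on (model M) (\<phi> ` (U \<inter> W)) (\<psi> \<circ> inv_into U \<phi>))"

text \<open>Functions, tangent vectors, covectors and sections are represented by total functions that
  vanish outside their domain, so that HOL equality is equality on the domain.\<close>

definition smooth_functions :: "('m, 'e::euclidean_space) manifold \<Rightarrow> ('m \<Rightarrow> real) set" where
  "smooth_functions M =
     {f. (\<forall>(U, \<phi>)\<in>atlas M. smooth_on (model M) (\<phi> ` U) (f \<circ> inv_into U \<phi>)) \<and>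
         (\<forall>p. p \<notin> topspace (mtop M) \<longrightarrow> f p = 0)}"

definition tangent_space ::
  "('m, 'e::euclidean_space) manifold \<Rightarrow> 'm \<Rightarrow> (('m \<Rightarrow> real) \<Rightarrow> real) set" where
  "tangent_space M p =
     {v. (\<forall>f\<in>smooth_functions M. \<forall>g\<in>smooth_functions M.
            v (f + g) = v f + v g \<and> v (f * g) = v f * g p + f p * v g) \<and>
         (\<forall>c. \<forall>f\<in>smooth_functions M. v (\<lambda>q. c * f q) = c * v f) \<and>
         (\<forall>f. f \<notin> smooth_functions M \<longrightarrow> v f = 0)}"

definition cotangent_space ::
  "('m, 'e::euclidean_space) manifold \<Rightarrow> 'm \<Rightarrow> ((('m \<Rightarrow> real) \<Rightarrow> real) \<Rightarrow> real) set" where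
  "cotangent_space M p =
     {a. (\<forall>v\<in>tangent_space M p. \<forall>w\<in>tangent_space M p. a (v + w) = a v + a w) \<and>
         (\<forall>c. \<forall>v\<in>tangent_space M p. a (\<lambda>f. c * v f) = c * a v) \<and>
         (\<forall>v. v \<notin> tangent_space M p \<longrightarrow> a v = 0)}"

type_synonym 'm vfield = "'m \<Rightarrow> ('m \<Rightarrow> real) \<Rightarrow> real"
type_synonym 'm form1 = "'m \<Rightarrow> (('m \<Rightarrow> real) \<Rightarrow> real) \<Rightarrow> real"

definition vector_fields :: "('m, 'e::euclidean_space) manifold \<Rightarrow> 'm vfield set" where
  "vector_fields M =
     {X. (\<forall>p\<in>topspace (mtop M). X p \<in> tangent_space M p) \<and>
         (\<forall>p. p \<notin> topspace (mtop M) \<longrightarrow> X p = 0) \<and>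
         (\<forall>f\<in>smooth_functions M. (\<lambda>p. X p f) \<in> smooth_functions M)}"

definition pairing :: "'m form1 \<Rightarrow> 'm vfield \<Rightarrow> 'm \<Rightarrow> real" where
  "pairing \<xi> X = (\<lambda>p. \<xi> p (X p))"

definition one_forms :: "('m, 'e::euclidean_space) manifold \<Rightarrow> 'm form1 set" where
  "one_forms M =
     {\<xi>. (\<forall>p\<in>topspace (mtop M). \<xi> p \<in> cotangent_space M p) \<and>
         (\<forall>p. p \<notin> topspace (mtop M) \<longrightarrow> \<xi> p = 0) \<and>
         (\<forall>X\<in>vector_fields M. pairing \<xi> X \<in> smooth_functions M)}"

text \<open>\<open>(X, \<xi>)\<close> stands for the section \<open>X + \<xi>\<close>.\<close>

type_synonym 'm gsection = "'m vfield \<times> 'm form1"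

definition gen_sections :: "('m, 'e::euclidean_space) manifold \<Rightarrow> 'm gsection set" where
  "gen_sections M = vector_fields M \<times> one_forms M"

definition fscale :: "('m \<Rightarrow> real) \<Rightarrow> ('m \<Rightarrow> 'b \<Rightarrow> real) \<Rightarrow> 'm \<Rightarrow> 'b \<Rightarrow> real" where
  "fscale f Z = (\<lambda>p a. f p * Z p a)"

definition gscale :: "('m \<Rightarrow> real) \<Rightarrow> 'm gsection \<Rightarrow> 'm gsection" where
  "gscale f u = (fscale f (fst u), fscale f (snd u))"

definition module_map ::
  "'r set \<Rightarrow> ('r \<Rightarrow> 'a::plus \<Rightarrow> 'a) \<Rightarrow> 'a set \<Rightarrow> ('r \<Rightarrow> 'b::plus \<Rightarrow> 'b) \<Rightarrow> 'b set \<Rightarrow> ('a \<Rightarrow> 'b) \<Rightarrow> bool" where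
  "module_map R sA A sB B T \<longleftrightarrow>
     (\<forall>x\<in>A. T x \<in> B) \<and>
     (\<forall>x\<in>A. \<forall>y\<in>A. T (x + y) = T x + T y) \<and>
     (\<forall>r\<in>R. \<forall>x\<in>A. T (sA r x) = sB r (T x))"

definition gen_symplectic ::
  "('m, 'e::euclidean_space) manifold \<Rightarrow> ('m gsection \<Rightarrow> 'm gsection \<Rightarrow> 'm \<Rightarrow> real) \<Rightarrow> bool" where
  "gen_symplectic M \<Omega> \<longleftrightarrow>
     (\<forall>u\<in>gen_sections M.
        module_map (smooth_functions M) gscale (gen_sections M) (*) (smooth_functions M) (\<lambda>v. \<Omega> u v)) \<and>
     (\<forall>v\<in>gen_sections M.
        module_map (smooth_functions M) gscale (gen_sections M) (*) (smooth_functions M) (\<lambda>u. \<Omega> u v)) \<and>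
     (\<forall>u\<in>gen_sections M. \<forall>v\<in>gen_sections M. \<Omega> u v = - \<Omega> v u) \<and>
     (\<forall>u\<in>gen_sections M. (\<forall>v\<in>gen_sections M. \<Omega> u v = 0) \<longrightarrow> u = 0)"

definition nat_gen_metric :: "'m gsection \<Rightarrow> 'm gsection \<Rightarrow> 'm \<Rightarrow> real" where
  "nat_gen_metric u v = (\<lambda>p. 1/2 * (pairing (snd u) (fst v) p + pairing (snd v) (fst u) p))"

definition gen_endo ::
  "('m, 'e::euclidean_space) manifold \<Rightarrow> ('m gsection \<Rightarrow> 'm gsection) \<Rightarrow> bool" where
  "gen_endo M K \<longleftrightarrow>
     module_map (smooth_functions M) gscale (gen_sections M) gscale (gen_sections M) K"

definition dual_map ::
  "('m, 'e::euclidean_space) manifold \<Rightarrow> ('m vfield \<Rightarrow> 'm vfield) \<Rightarrow> 'm form1 \<Rightarrow> 'm form1" where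
  "dual_map M H \<xi> =
     (THE \<zeta>. \<zeta> \<in> one_forms M \<and> (\<forall>X\<in>vector_fields M. pairing \<zeta> X = pairing \<xi> (H X)))"

definition block_map ::
  "('m vfield \<Rightarrow> 'm vfield) \<Rightarrow> ('m form1 \<Rightarrow> 'm vfield) \<Rightarrow>
   ('m vfield \<Rightarrow> 'm form1) \<Rightarrow> ('m form1 \<Rightarrow> 'm form1) \<Rightarrow> 'm gsection \<Rightarrow> 'm gsection" where
  "block_map H \<sigma> \<tau> K u = (H (fst u) + \<sigma> (snd u), \<tau> (fst u) + K (snd u))"

definition skew_block_form ::
  "('m, 'e::euclidean_space) manifold \<Rightarrow> ('m gsection \<Rightarrow> 'm gsection) \<Rightarrow> bool" where
  "skew_block_form M K \<longleftrightarrow>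
     (\<exists>H \<sigma> \<tau>.
        module_map (smooth_functions M) fscale (vector_fields M) fscale (vector_fields M) H \<and>
        module_map (smooth_functions M) fscale (one_forms M) fscale (vector_fields M) \<sigma> \<and>
        module_map (smooth_functions M) fscale (vector_fields M) fscale (one_forms M) \<tau> \<and>
        (\<forall>X\<in>vector_fields M. \<forall>Y\<in>vector_fields M. pairing (\<tau> X) Y = - pairing (\<tau> Y) X) \<and>
        (\<forall>\<xi>\<in>one_forms M. \<forall>\<eta>\<in>one_forms M. pairing \<xi> (\<sigma> \<eta>) = - pairing \<eta> (\<sigma> \<xi>)) \<and>
        (\<forall>u\<in>gen_sections M. K u = block_map H \<sigma> \<tau> (\<lambda>\<xi>. - dual_map M H \<xi>) u))"

end

theory Submission
  imports Defs
begin

text \<open>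
  Everything reduces to the fact that \<open>\<X>(M)\<close> and \<open>\<Lambda>\<^sup>1(M)\<close> are each other's duals over the smooth
  functions; then \<open>\<K> u\<close> is the unique section representing \<open>\<Omega> u\<close> with respect to the natural metric,
  and the block form is a transcription of skew-symmetry.

  Both dualities follow from a global substitute for a local frame around a point \<open>p\<close>: finitely many
  smooth functions \<open>x\<^sub>i\<close>, vector fields \<open>E\<^sub>i\<close> and a function \<open>\<kappa>\<close> with \<open>\<kappa>(p) \<noteq> 0\<close>, such that
  \<open>\<kappa>(q) v = \<Sum>\<^sub>i v(x\<^sub>i) E\<^sub>i(q)\<close> for all tangent vectors \<open>v\<close> at all points \<open>q\<close>. A linear functional on
  \<open>\<X>(M)\<close> is thereby determined at \<open>p\<close> by its values on the \<open>E\<^sub>i\<close>; a linear functional \<open>b\<close> on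
  \<open>\<Lambda>\<^sup>1(M)\<close> comes from the vector field \<open>f \<mapsto> b(df)\<close>.

  The frame is built from a bump function \<open>\<psi>\<close> supported in a chart \<open>y\<close>. No plateau is needed: with
  \<open>x\<^sub>i = \<psi> y\<^sub>i\<close>, \<open>E\<^sub>i = \<psi> \<partial>\<^sub>i\<close> and the extra pair \<open>x\<^sub>0 = \<psi>\<close>, \<open>E\<^sub>0 = - \<Sum>\<^sub>i x\<^sub>i \<partial>\<^sub>i\<close>, the product rule and
  Hadamard's lemma give the identity with \<open>\<kappa> = \<psi>\<^sup>2\<close>.
\<close>

section \<open>Calculus of smooth functions on open sets\<close>

text \<open>A derivative at a point of \<open>S\<close> depends only on values nearby, and
  \<open>S\<close> is open. So the derivatives agree on \<open>S\<close> too, and the induction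
  passes to them.\<close>

lemma Ck_on_cong:
  fixes f g :: "'a::euclidean_space \<Rightarrow> 'b::real_normed_vector"
  assumes S: "open S" and "\<And>x. x \<in> S \<Longrightarrow> f x = g x" "Ck_on UNIV k S f"
  shows "Ck_on UNIV k S g"
  using assms(2,3)
proof (induction k arbitrary: f g)
  case 0
  then show ?case by (simp cong: continuous_on_cong)
next
  case (Suc k)
  have D: "(g has_derivative frechet_derivative f (at x)) (at x)" if "x \<in> S" for x
  proof -
    have "(f has_derivative frechet_derivative f (at x)) (at x)"
      using Suc.prems that by (simp add: frechet_derivative_works)
    then show ?thesis
      using S that Suc.prems(1) by (rule has_derivative_transform_within_open)
  qed
  have "Ck_on UNIV k S (\<lambda>x. frechet_derivative g (at x) v)" for v
    by (rule Suc.IH[of "\<lambda>x. frechet_derivative f (at x) v"])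
       (use Suc.prems(2) frechet_derivative_at[OF D] in auto)
  then show ?case
    using D by (auto simp: differentiable_def)
qed

text \<open>Allows any explicit derivative formula in place of the choice operator
  \<open>frechet_derivative\<close>: by uniqueness of derivatives the two agree on
  \<open>S\<close>.\<close>

lemma Ck_on_SucI:
  assumes f: "\<And>x. x \<in> S \<Longrightarrow> (f has_derivative f' x) (at x)"
    and f': "\<And>v. Ck_on UNIV k S (\<lambda>x. f' x v)" and "open S"
  shows "Ck_on UNIV (Suc k) S f"
proof -
  have "Ck_on UNIV k S (\<lambda>x. frechet_derivative f (at x) v)" for v
    by (rule Ck_on_cong[OF \<open>open S\<close> _ f'[of v]]) (simp add: frechet_derivative_at[OF f, symmetric])
  then show ?thesis
    using f by (auto simp: differentiable_def)
qed

lemma Ck_on_SucD: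
  assumes "Ck_on UNIV (Suc k) S f"
  shows "x \<in> S \<Longrightarrow> (f has_derivative frechet_derivative f (at x)) (at x)"
    and "Ck_on UNIV k S (\<lambda>x. frechet_derivative f (at x) v)"
  using assms by (simp_all add: frechet_derivative_works)

lemma Ck_on_Suc_imp: "Ck_on UNIV (Suc k) S f \<Longrightarrow> Ck_on UNIV k S f"
proof (induction k arbitrary: f)
  case 0
  then show ?case
    by (auto intro!: continuous_at_imp_continuous_on differentiable_imp_continuous_within)
next
  case (Suc k)
  then show ?case
    unfolding Ck_on.simps(2)[of UNIV "Suc k"] Ck_on.simps(2)[of UNIV k S f] by blast
qed

lemma Ck_on_subset: "Ck_on V k S f \<Longrightarrow> T \<subseteq> S \<Longrightarrow> Ck_on V k T f"
  by (induction k arbitrary: f) (auto intro: continuous_on_subset)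

text \<open>Glues local smoothness; for a function extended by zero, the neighbourhoods come from
  two different open sets.\<close>

lemma Ck_on_local:
  assumes "\<And>x. x \<in> S \<Longrightarrow> \<exists>T. open T \<and> x \<in> T \<and> Ck_on UNIV k T f"
  shows "Ck_on UNIV k S f"
  using assms
proof (induction k arbitrary: f)
  case 0
  have "isCont f x" if "x \<in> S" for x
    using 0[OF that] by (auto simp: continuous_on_eq_continuous_at)
  then show ?case
    by (simp add: continuous_at_imp_continuous_on)
next
  case (Suc k)
  have "Ck_on UNIV k S (\<lambda>x. frechet_derivative f (at x) v)" for v
    using Suc.prems by (intro Suc.IH) fastforce
  moreover have "f differentiable (at x)" if "x \<in> S" for x
    using Suc.prems[OF that] by auto
  ultimately show ?case by simp
qed

lemma Ck_on_const: "open S \<Longrightarrow> Ck_on UNIV k S (\<lambda>x. c)"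
proof (induction k arbitrary: c)
  case (Suc k)
  then show ?case
    by (intro Ck_on_SucI[where f' = "\<lambda>x v. 0"]) (auto intro!: derivative_eq_intros)
qed simp

lemma Ck_on_linear:
  assumes "open S" "bounded_linear f"
  shows "Ck_on UNIV k S f"
proof (cases k)
  case 0
  then show ?thesis using assms by (simp add: linear_continuous_on)
next
  case (Suc j)
  then show ?thesis
    using assms unfolding Suc
    by (intro Ck_on_SucI[where f' = "\<lambda>x. f"] Ck_on_const bounded_linear_imp_has_derivative)
qed

lemma Ck_on_bounded_linear:
  assumes "open S" "bounded_linear L" "Ck_on UNIV k S f"
  shows "Ck_on UNIV k S (\<lambda>x. L (f x))"
  using assms(3)
proof (induction k arbitrary: f)
  case 0
  then show ?case using assms by (simp add: bounded_linear.continuous_on)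
next
  case (Suc k)
  note D = Ck_on_SucD[OF Suc.prems]
  show ?case
    by (intro Ck_on_SucI[where f' = "\<lambda>x v. L (frechet_derivative f (at x) v)"] Suc.IH D(2) assms(1)
        bounded_linear.has_derivative[OF assms(2)] D(1))
qed

lemma Ck_on_add:
  assumes "open S" "Ck_on UNIV k S f" "Ck_on UNIV k S g"
  shows "Ck_on UNIV k S (\<lambda>x. f x + g x)"
  using assms(2,3)
proof (induction k arbitrary: f g)
  case 0
  then show ?case by (simp add: continuous_on_add)
next
  case (Suc k)
  note D = Ck_on_SucD[OF Suc.prems(1)] Ck_on_SucD[OF Suc.prems(2)]
  show ?case
    by (intro Ck_on_SucI[where f' = "\<lambda>x v. frechet_derivative f (at x) v + frechet_derivative g (at x) v"]
        Suc.IH D assms(1) has_derivative_add)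
qed

lemma Ck_on_mult:
  fixes f g :: "'a::euclidean_space \<Rightarrow> real"
  assumes "open S" "Ck_on UNIV k S f" "Ck_on UNIV k S g"
  shows "Ck_on UNIV k S (\<lambda>x. f x * g x)"
  using assms(2,3)
proof (induction k arbitrary: f g)
  case 0
  then show ?case by (simp add: continuous_on_mult)
next
  case (Suc k)
  note D = Ck_on_SucD[OF Suc.prems(1)] Ck_on_SucD[OF Suc.prems(2)]
  show ?case
    by (intro Ck_on_SucI[where f' = "\<lambda>x v. f x * frechet_derivative g (at x) v + frechet_derivative f (at x) v * g x"]
        Suc.IH D assms(1) has_derivative_mult Ck_on_add
        Ck_on_Suc_imp[OF Suc.prems(1)] Ck_on_Suc_imp[OF Suc.prems(2)])
qed

lemma Ck_on_sum:
  assumes "open S" "\<And>i. i \<in> I \<Longrightarrow> Ck_on UNIV k S (f i)"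
  shows "Ck_on UNIV k S (\<lambda>x. \<Sum>i\<in>I. f i x)"
  using assms(2) by (induction I rule: infinite_finite_induct) (auto intro: Ck_on_const Ck_on_add assms(1))

lemma linear_eq_sum_Basis:
  fixes L :: "'a::euclidean_space \<Rightarrow> real"
  assumes "linear L"
  shows "L v = (\<Sum>b\<in>Basis. (v \<bullet> b) * L b)"
  using Linear_Algebra.linear_componentwise[OF assms, of v 1] by simp

text \<open>By the chain rule the derivative is a sum of products of a component of the derivative
  of \<open>g\<close> with a partial derivative of \<open>f\<close> evaluated at \<open>g x\<close>.
  The induction hypothesis, for the same \<open>g\<close> and all real-valued \<open>f\<close>,
  covers the second factors.\<close>

lemma Ck_on_compose:
  fixes f :: "'b::euclidean_space \<Rightarrow> real" and g :: "'a::euclidean_space \<Rightarrow> 'b"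
  assumes "open S" "open T" "g ` S \<subseteq> T" "Ck_on UNIV k T f" "Ck_on UNIV k S g"
  shows "Ck_on UNIV k S (\<lambda>x. f (g x))"
  using assms(4,5)
proof (induction k arbitrary: f)
  case 0
  then show ?case using assms(3) by (auto intro: continuous_on_compose2)
next
  case (Suc k)
  note Df = Ck_on_SucD[OF Suc.prems(1)] and Dg = Ck_on_SucD[OF Suc.prems(2)]
  show ?case
  proof (rule Ck_on_SucI[where f' = "\<lambda>x v. \<Sum>b\<in>Basis. (frechet_derivative g (at x) v \<bullet> b) * frechet_derivative f (at (g x)) b"])
    fix x assume x: "x \<in> S"
    then have f: "(f has_derivative frechet_derivative f (at (g x))) (at (g x))"
      using assms(3) Df(1) by blast
    have eq: "frechet_derivative f (at (g x)) \<circ> frechet_derivative g (at x) =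
        (\<lambda>v. \<Sum>b\<in>Basis. (frechet_derivative g (at x) v \<bullet> b) * frechet_derivative f (at (g x)) b)"
      unfolding o_def
      by (rule ext) (rule linear_eq_sum_Basis[OF has_derivative_linear[OF f]])
    show "((\<lambda>x. f (g x)) has_derivative (\<lambda>v. \<Sum>b\<in>Basis. (frechet_derivative g (at x) v \<bullet> b) * frechet_derivative f (at (g x)) b)) (at x)"
      using diff_chain_at[OF Dg(1)[OF x] f] unfolding eq by (simp add: o_def)
  next
    fix v
    show "Ck_on UNIV k S (\<lambda>x. \<Sum>b\<in>Basis. (frechet_derivative g (at x) v \<bullet> b) * frechet_derivative f (at (g x)) b)"
      by (intro Ck_on_sum Ck_on_mult assms(1) Suc.IH Df(2) Ck_on_Suc_imp[OF Suc.prems(2)]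
          Ck_on_bounded_linear[OF assms(1) bounded_linear_inner_left] Dg(2))
  qed (rule assms(1))
qed

text \<open>The negative powers make the family closed under differentiation, so that smoothness of
  \<open>exp (- 1 / x)\<close> at 0 is an induction.\<close>

definition flat :: "nat \<Rightarrow> real \<Rightarrow> real" where
  "flat n x = (if x > 0 then inverse x ^ n * exp (- inverse x) else 0)"

lemma flat_tendsto_0: "((\<lambda>x. flat n x) \<longlongrightarrow> 0) (at 0)"
proof -
  have "((\<lambda>x::real. x ^ n / exp x) \<longlongrightarrow> 0) at_top"
    by (rule tendsto_power_div_exp_0)
  \<comment> \<open>The substitution of \<open>inverse x\<close> turns the decay of powers against
    \<open>exp\<close> at infinity into a limit at 0 from the right.\<close>
  then have "((\<lambda>x::real. inverse x ^ n / exp (inverse x)) \<longlongrightarrow> 0) (at_right 0)"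
    by (rule filterlim_compose[OF _ filterlim_inverse_at_top_right])
  then have "(flat n \<longlongrightarrow> 0) (at_right 0)"
    by (rule Lim_transform_eventually)
      (auto simp: eventually_at_right_field flat_def exp_minus field_simps intro!: exI[of _ 1])
  moreover have "(flat n \<longlongrightarrow> 0) (at_left 0)"
    by (rule tendsto_eventually) (auto simp: flat_def eventually_at_left_field intro!: exI[of _ "-1"])
  ultimately show ?thesis
    by (simp add: filterlim_at_split)
qed

lemma flat_has_derivative:
  "(flat n has_real_derivative (flat (n + 2) x - n * flat (n + 1) x)) (at x)"
proof -
  consider "x > 0" | "x < 0" | "x = 0" by linarith
  then show ?thesis
  proof cases
    case 1
    have "((\<lambda>x. inverse x ^ n * exp (- inverse x)) has_real_derivative (flat (n + 2) x - n * flat (n + 1) x)) (at x)"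
      using 1
      by (auto intro!: derivative_eq_intros simp: flat_def power2_eq_square algebra_simps)
        (cases n, auto)
    then show ?thesis
      by (rule has_field_derivative_transform_within_open[of _ _ _ "{0<..}"])
         (use 1 in \<open>auto simp: flat_def\<close>)
  next
    case 2
    have "((\<lambda>x. 0) has_real_derivative (flat (n + 2) x - n * flat (n + 1) x)) (at x)"
      using 2 by (simp add: flat_def)
    then show ?thesis
      by (rule has_field_derivative_transform_within_open[of _ _ _ "{..<0}"])
         (use 2 in \<open>auto simp: flat_def\<close>)
  next
    case 3
    \<comment> \<open>At 0 the difference quotient of \<open>flat n\<close> is itself
      \<open>flat (Suc n)\<close>, whose limit is already known to be 0.\<close>
    have "flat (Suc n) y = (flat n y - flat n 0) / (y - 0)" for y
      by (simp add: flat_def divide_simps)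
    then show ?thesis
      using flat_tendsto_0[of "Suc n"] 3
      by (simp add: has_field_derivative_iff flat_def)
  qed
qed

lemma Ck_on_flat: "Ck_on UNIV k UNIV (flat n)"
proof (induction k arbitrary: n)
  case 0
  show ?case
    using DERIV_isCont[OF flat_has_derivative] by (simp add: continuous_at_imp_continuous_on)
next
  case (Suc k)
  show ?case
  \<comment> \<open>The difference is written as a sum with the factor \<open>- real n\<close>, so
    that closure under sums, products and constants applies.\<close>
  proof (rule Ck_on_SucI[where f' = "\<lambda>x v. v * (flat (n + 2) x + (- real n) * flat (n + 1) x)"])
    show "(flat n has_derivative (\<lambda>v. v * (flat (n + 2) x + (- real n) * flat (n + 1) x))) (at x)" for x
      using flat_has_derivative[of n x] unfolding has_field_derivative_def
      by (rule has_derivative_eq_rhs) (auto simp: fun_eq_iff)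
    show "Ck_on UNIV k UNIV (\<lambda>x. v * (flat (n + 2) x + (- real n) * flat (n + 1) x))" for v
      by (intro Ck_on_mult Ck_on_add Ck_on_const Suc.IH open_UNIV)
  qed auto
qed

section \<open>Segment integrals and Hadamard's lemma\<close>

text \<open>Differentiation under the integral sign. The inner map
  \<open>q + t *\<^sub>R (y - q)\<close> contributes a factor \<open>t\<close>, so the weight
  \<open>t ^ m\<close> becomes \<open>t ^ Suc m\<close>; keeping \<open>m\<close> arbitrary makes
  the family of segment integrals closed under differentiation.\<close>

lemma has_derivative_segment_integral:
  fixes h :: "'a::euclidean_space \<Rightarrow> real"
  assumes U: "open U" "convex U" "q \<in> U" and h: "Ck_on UNIV (Suc 0) U h" and y: "y \<in> U"
  shows "((\<lambda>y. integral {0..1} (\<lambda>t. t ^ m * h (q + t *\<^sub>R (y - q)))) has_derivative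
          (\<lambda>v. integral {0..1} (\<lambda>t. t ^ Suc m * frechet_derivative h (at (q + t *\<^sub>R (y - q))) v))) (at y)"
proof -
  note D = Ck_on_SucD[OF h]
  have seg: "q + t *\<^sub>R (y - q) \<in> U" if "y \<in> U" "t \<in> {0..1}" for t y
    using convexD[OF U(2,3) that(1), of "1 - t" t] that(2) by (simp add: algebra_simps)
  \<comment> \<open>\<open>leibniz_rule\<close> expects a continuous family of bounded linear maps.
    Expanding the derivative in partial derivatives reduces its continuity to theirs.\<close>
  define F where "F y t = (\<Sum>b\<in>Basis. (t ^ Suc m * frechet_derivative h (at (q + t *\<^sub>R (y - q))) b) *\<^sub>R blinfun_inner_left b)"
    for y and t :: real
  have F: "blinfun_apply (F y t) v = t ^ Suc m * frechet_derivative h (at (q + t *\<^sub>R (y - q))) v"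
    if "y \<in> U" "t \<in> {0..1}" for y t v
    using linear_eq_sum_Basis[OF has_derivative_linear[OF D(1)[OF seg[OF that]]], of v]
    by (simp add: F_def blinfun.sum_left blinfun.scaleR_left sum_distrib_left inner_commute mult_ac)
  have cont: "continuous_on (U \<times> {0..1}) (\<lambda>(y, t). F y t)"
    unfolding F_def case_prod_beta
    by (intro continuous_intros continuous_on_compose2[OF D(2)[unfolded Ck_on.simps]]) (use seg in auto)
  have conth: "continuous_on U h"
    using Ck_on_Suc_imp[OF h] by simp
  have "((\<lambda>y. integral (cbox 0 1) (\<lambda>t. t ^ m * h (q + t *\<^sub>R (y - q)))) has_derivative
      blinfun_apply (integral (cbox 0 1) (F y))) (at y within U)"
  proof (rule leibniz_rule)
    fix y and t :: real assume yt: "y \<in> U" "t \<in> cbox 0 1"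
    have "((\<lambda>y. q + t *\<^sub>R (y - q)) has_derivative (\<lambda>v. t *\<^sub>R v)) (at y)"
      by (auto intro!: derivative_eq_intros)
    from diff_chain_at[OF this D(1)[OF seg]] yt
    have "((\<lambda>y. h (q + t *\<^sub>R (y - q))) has_derivative (\<lambda>v. frechet_derivative h (at (q + t *\<^sub>R (y - q))) (t *\<^sub>R v))) (at y)"
      by (simp add: o_def)
    then have "((\<lambda>y. t ^ m * h (q + t *\<^sub>R (y - q))) has_derivative (\<lambda>v. t ^ m * frechet_derivative h (at (q + t *\<^sub>R (y - q))) (t *\<^sub>R v))) (at y)"
      by (rule has_derivative_mult_right)
    also have "(\<lambda>v. t ^ m * frechet_derivative h (at (q + t *\<^sub>R (y - q))) (t *\<^sub>R v)) = blinfun_apply (F y t)"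
      using yt F linear_cmul[OF has_derivative_linear[OF D(1)[OF seg]]] by (auto simp: fun_eq_iff mult_ac)
    finally show "((\<lambda>y. t ^ m * h (q + t *\<^sub>R (y - q))) has_derivative blinfun_apply (F y t)) (at y within U)"
      by (rule has_derivative_at_withinI)
  next
    fix y assume "y \<in> U"
    then show "(\<lambda>t. t ^ m * h (q + t *\<^sub>R (y - q))) integrable_on cbox 0 1"
      by (intro integrable_continuous continuous_intros continuous_on_compose2[OF conth]) (use seg in auto)
  qed (use U y cont in auto)
  moreover have "blinfun_apply (integral (cbox 0 1) (F y)) =
      (\<lambda>v. integral {0..1} (\<lambda>t. t ^ Suc m * frechet_derivative h (at (q + t *\<^sub>R (y - q))) v))"
  proof
    fix v
    have "continuous_on {0..1} (F y)"
      using continuous_on_compose2[OF cont, of "{0..1}" "\<lambda>t. (y, t)"] y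
      by (simp add: image_subset_iff continuous_on_Pair)
    then have "F y integrable_on cbox 0 1"
      by (simp add: integrable_continuous_interval)
    then show "blinfun_apply (integral (cbox 0 1) (F y)) v =
        integral {0..1} (\<lambda>t. t ^ Suc m * frechet_derivative h (at (q + t *\<^sub>R (y - q))) v)"
      by (subst blinfun_apply_integral) (use F y in \<open>auto intro!: integral_cong\<close>)
  qed
  ultimately show ?thesis
    using at_within_open[OF y U(1)] by simp
qed

lemma Ck_on_segment_integral:
  fixes h :: "'a::euclidean_space \<Rightarrow> real"
  assumes U: "open U" "convex U" "q \<in> U" and "\<And>j. Ck_on UNIV j U h"
  shows "Ck_on UNIV k U (\<lambda>y. integral {0..1} (\<lambda>t. t ^ m * h (q + t *\<^sub>R (y - q))))"
  using assms(4)
proof (induction k arbitrary: h m)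
  case 0
  show ?case
    using has_derivative_continuous[OF has_derivative_segment_integral[OF U 0]]
    by (auto intro!: continuous_at_imp_continuous_on)
next
  case (Suc k)
  show ?case
    by (rule Ck_on_SucI[OF has_derivative_segment_integral[OF U Suc.prems] Suc.IH U(1)])
       (auto intro: Ck_on_SucD(2)[OF Suc.prems])
qed

text \<open>Integrate the derivative of \<open>f\<close> along the segment from \<open>q\<close> to
  \<open>y\<close> and expand the direction \<open>y - q\<close> in the basis; \<open>g b\<close> is
  the mean of the partial derivative in direction \<open>b\<close> over that segment.\<close>

lemma Hadamard:
  fixes f :: "'a::euclidean_space \<Rightarrow> real"
  assumes U: "open U" "convex U" "q \<in> U" and f: "smooth_on UNIV U f"
  obtains g where "\<And>b. smooth_on UNIV U (g b)"
    "\<And>b. g b q = frechet_derivative f (at q) b"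
    "\<And>y. y \<in> U \<Longrightarrow> f y = f q + (\<Sum>b\<in>Basis. ((y - q) \<bullet> b) * g b y)"
proof
  have Ck: "Ck_on UNIV k U f" for k
    using f by (simp add: smooth_on_def)
  note D = Ck_on_SucD[OF Ck]
  \<comment> \<open>The trivial weight \<open>t ^ 0\<close> gives the integrals the shape required
    by \<open>Ck_on_segment_integral\<close>.\<close>
  let ?g = "\<lambda>b y. integral {0..1} (\<lambda>t::real. t ^ 0 * frechet_derivative f (at (q + t *\<^sub>R (y - q))) b)"
  show "smooth_on UNIV U (?g b)" for b
    unfolding smooth_on_def by (intro allI Ck_on_segment_integral U D(2))
  show "?g b q = frechet_derivative f (at q) b" for b
    by simp
  fix y assume y: "y \<in> U"
  have seg: "q + t *\<^sub>R (y - q) \<in> U" if "t \<in> {0..1}" for t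
    using convexD[OF U(2,3) y, of "1 - t" t] that by (simp add: algebra_simps)
  have "((\<lambda>t. frechet_derivative f (at (q + t *\<^sub>R (y - q))) (y - q)) has_integral
      f (q + 1 *\<^sub>R (y - q)) - f (q + 0 *\<^sub>R (y - q))) {0..1}"
  proof (rule fundamental_theorem_of_calculus)
    fix t :: real assume t: "t \<in> {0..1}"
    have "((\<lambda>t. q + t *\<^sub>R (y - q)) has_derivative (\<lambda>s. s *\<^sub>R (y - q))) (at t)"
      by (auto intro!: derivative_eq_intros)
    from diff_chain_at[OF this D(1)[OF seg[OF t]]]
    have "((\<lambda>t. f (q + t *\<^sub>R (y - q))) has_derivative (\<lambda>s. s *\<^sub>R frechet_derivative f (at (q + t *\<^sub>R (y - q))) (y - q))) (at t)"
      by (simp add: o_def linear_cmul[OF has_derivative_linear[OF D(1)[OF seg[OF t]]]])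
    then show "((\<lambda>t. f (q + t *\<^sub>R (y - q))) has_vector_derivative frechet_derivative f (at (q + t *\<^sub>R (y - q))) (y - q)) (at t within {0..1})"
      unfolding has_vector_derivative_def by (rule has_derivative_at_withinI)
  qed simp
  then have "f y - f q = integral {0..1} (\<lambda>t. frechet_derivative f (at (q + t *\<^sub>R (y - q))) (y - q))"
    by (simp add: integral_unique)
  also have "\<dots> = integral {0..1} (\<lambda>t. \<Sum>b\<in>Basis. ((y - q) \<bullet> b) * frechet_derivative f (at (q + t *\<^sub>R (y - q))) b)"
    by (intro integral_cong linear_eq_sum_Basis has_derivative_linear[OF D(1)] seg)
  also have "\<dots> = (\<Sum>b\<in>Basis. integral {0..1} (\<lambda>t. ((y - q) \<bullet> b) * frechet_derivative f (at (q + t *\<^sub>R (y - q))) b))"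
    by (intro integral_sum integrable_continuous_interval continuous_intros
        continuous_on_compose2[OF D(2)[where k = 0, unfolded Ck_on.simps]]) (use seg in auto)
  finally show "f y = f q + (\<Sum>b\<in>Basis. ((y - q) \<bullet> b) * ?g b y)"
    by simp
qed

section \<open>Charts, smooth functions and tangent vectors\<close>

text \<open>The filter \<open>at 0 within {0}\<close> is trivial, so the limit condition in
  differentiability is vacuous. Smoothness is therefore automatic on zero-dimensional
  manifolds.\<close>

lemma Ck_on_zero_model:
  fixes f :: "'a::euclidean_space \<Rightarrow> 'b::real_normed_vector"
  assumes "S \<subseteq> {0}"
  shows "Ck_on {0} k S f"
proof (induction k arbitrary: f)
  case 0
  show ?case
    unfolding Ck_on.simps using assms by (rule continuous_on_subset[OF continuous_on_sing])
next
  case (Suc k)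
  have "at (0::'a) within {0} = bot"
    by (simp add: at_within_def)
  then have "(f has_derivative (\<lambda>v. 0)) (at x within {0})" if "x \<in> S" for x
    using that assms by (auto simp: has_derivative_def)
  then have "f differentiable (at x within {0})" if "x \<in> S" for x
    using that differentiableI by blast
  then show ?case
    using Suc by simp
qed

context
  fixes M :: "('m, 'e::euclidean_space) manifold"
  assumes M: "smooth_manifold M"
begin

section \<open>Topology of charts\<close>

lemma model_cases: "model M = UNIV \<or> model M = {0}"
  using M by (auto simp: smooth_manifold_def)

lemma atlas_cover: "p \<in> topspace (mtop M) \<Longrightarrow> \<exists>(U, \<phi>) \<in> atlas M. p \<in> U"
  using M by (auto simp: smooth_manifold_def)

lemma
  assumes "(U, \<phi>) \<in> atlas M"
  shows chart_open: "openin (mtop M) U"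
    and chart_image_openin: "openin (top_of_set (model M)) (\<phi> ` U)"
    and chart_homeo: "homeomorphic_map (subtopology (mtop M) U) (top_of_set (\<phi> ` U)) \<phi>"
  using M assms unfolding smooth_manifold_def by blast+

lemma chart_transition:
  "(U, \<phi>) \<in> atlas M \<Longrightarrow> (W, \<psi>) \<in> atlas M \<Longrightarrow>
    smooth_on (model M) (\<phi> ` (U \<inter> W)) (\<psi> \<circ> inv_into U \<phi>)"
  using M unfolding smooth_manifold_def by blast

lemma chart_subset: "(U, \<phi>) \<in> atlas M \<Longrightarrow> U \<subseteq> topspace (mtop M)"
  using chart_open openin_subset by blast

lemma chart_inj:
  assumes "(U, \<phi>) \<in> atlas M"
  shows "inj_on \<phi> U"
  using homeomorphic_imp_injective_map[OF chart_homeo[OF assms]] chart_subset[OF assms]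
  by (simp add: Int_absorb1)

lemma chart_inv [simp]: "(U, \<phi>) \<in> atlas M \<Longrightarrow> q \<in> U \<Longrightarrow> inv_into U \<phi> (\<phi> q) = q"
  using chart_inj by simp

lemma chart_open_image:
  assumes "model M = UNIV" "(U, \<phi>) \<in> atlas M" "openin (mtop M) N" "N \<subseteq> U"
  shows "open (\<phi> ` N)"
proof -
  have "openin (subtopology (mtop M) U) N"
    using assms by (meson openin_subset_topspace_eq openin_subtopology_Int2 chart_open openin_open_subtopology)
  then have "openin (top_of_set (\<phi> ` U)) (\<phi> ` N)"
    using homeomorphic_imp_open_map[OF chart_homeo[OF assms(2)]] by (simp add: open_map_def)
  moreover have "open (\<phi> ` U)"
    using chart_image_openin[OF assms(2)] assms(1) by simp
  ultimately show ?thesis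
    using openin_open_trans by blast
qed

lemma chart_open_vimage:
  assumes "(U, \<phi>) \<in> atlas M" "open A"
  shows "openin (mtop M) {q \<in> U. \<phi> q \<in> A}"
proof -
  have "continuous_map (subtopology (mtop M) U) euclidean \<phi>"
    using homeomorphic_imp_continuous_map[OF chart_homeo[OF assms(1)]] continuous_map_in_subtopology by blast
  then have "openin (subtopology (mtop M) U) {q \<in> topspace (subtopology (mtop M) U). \<phi> q \<in> A}"
    by (rule openin_continuous_map_preimage) (use assms(2) in simp)
  then show ?thesis
    using openin_trans_full chart_open[OF assms(1)] chart_subset[OF assms(1)] by (simp add: Int_absorb1)
qed

text \<open>The inverse chart carries \<open>K\<close> to a compact subset of the manifold, and
  compact subsets of a Hausdorff space are closed in the whole space, not just in \<open>U\<close>.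
  This is what permits extension by zero beyond the chart.\<close>

lemma chart_compact_vimage:
  assumes "(U, \<phi>) \<in> atlas M" "compact K" "K \<subseteq> \<phi> ` U"
  shows "closedin (mtop M) {q \<in> U. \<phi> q \<in> K}"
proof -
  obtain g where g: "homeomorphic_maps (subtopology (mtop M) U) (top_of_set (\<phi> ` U)) \<phi> g"
    using chart_homeo[OF assms(1)] homeomorphic_map_maps by blast
  then have inv: "q \<in> U \<Longrightarrow> g (\<phi> q) = q" for q
    using chart_subset[OF assms(1)] by (auto simp: homeomorphic_maps_def)
  have "compactin (top_of_set (\<phi> ` U)) K"
    using assms by (simp add: compactin_subtopology)
  then have "compactin (subtopology (mtop M) U) (g ` K)"
    using g image_compactin by (auto simp: homeomorphic_maps_def)
  moreover have "g ` K = {q \<in> U. \<phi> q \<in> K}"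
    using assms(3) inv by force
  ultimately have "compactin (mtop M) {q \<in> U. \<phi> q \<in> K}"
    by (simp add: compactin_subtopology)
  then show ?thesis
    using M compactin_imp_closedin by (auto simp: smooth_manifold_def)
qed

section \<open>The algebra of smooth functions\<close>

lemma smooth_functions_outside: "f \<in> smooth_functions M \<Longrightarrow> p \<notin> topspace (mtop M) \<Longrightarrow> f p = 0"
  by (simp add: smooth_functions_def)

lemma smooth_functionsI:
  assumes "\<And>U \<phi> k. model M = UNIV \<Longrightarrow> (U, \<phi>) \<in> atlas M \<Longrightarrow> open (\<phi> ` U) \<Longrightarrow>
      Ck_on UNIV k (\<phi> ` U) (\<lambda>x. f (inv_into U \<phi> x))"
    and "\<And>p. p \<notin> topspace (mtop M) \<Longrightarrow> f p = 0"
  shows "f \<in> smooth_functions M"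
proof -
  have "smooth_on (model M) (\<phi> ` U) (f \<circ> inv_into U \<phi>)" if "(U, \<phi>) \<in> atlas M" for U \<phi>
    using model_cases
  proof
    assume "model M = UNIV"
    then show ?thesis
      using assms(1)[OF _ that] chart_image_openin[OF that] by (simp add: smooth_on_def o_def)
  next
    assume "model M = {0}"
    then show ?thesis
      using chart_image_openin[OF that] Ck_on_zero_model openin_imp_subset by (metis smooth_on_def)
  qed
  then show ?thesis
    using assms(2) by (auto simp: smooth_functions_def)
qed

lemma smooth_functionsD:
  "f \<in> smooth_functions M \<Longrightarrow> model M = UNIV \<Longrightarrow> (U, \<phi>) \<in> atlas M \<Longrightarrow>
    Ck_on UNIV k (\<phi> ` U) (\<lambda>x. f (inv_into U \<phi> x))"
  unfolding smooth_functions_def smooth_on_def o_def by fastforce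

lemma smooth_functions_add:
  assumes "f \<in> smooth_functions M" "g \<in> smooth_functions M"
  shows "(\<lambda>p. f p + g p) \<in> smooth_functions M"
  by (rule smooth_functionsI)
     (simp_all add: Ck_on_add smooth_functionsD assms assms[THEN smooth_functions_outside])

lemma smooth_functions_mult:
  assumes "f \<in> smooth_functions M" "g \<in> smooth_functions M"
  shows "(\<lambda>p. f p * g p) \<in> smooth_functions M"
  by (rule smooth_functionsI)
     (simp_all add: Ck_on_mult smooth_functionsD assms assms[THEN smooth_functions_outside])

lemma smooth_functions_plus: "f \<in> smooth_functions M \<Longrightarrow> g \<in> smooth_functions M \<Longrightarrow> f + g \<in> smooth_functions M"
  unfolding plus_fun_def by (rule smooth_functions_add)

lemma smooth_functions_times: "f \<in> smooth_functions M \<Longrightarrow> g \<in> smooth_functions M \<Longrightarrow> f * g \<in> smooth_functions M"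
  unfolding times_fun_def by (rule smooth_functions_mult)

lemma smooth_functions_cmult:
  assumes "f \<in> smooth_functions M"
  shows "(\<lambda>p. c * f p) \<in> smooth_functions M"
  by (rule smooth_functionsI)
     (simp_all add: Ck_on_mult Ck_on_const smooth_functionsD assms assms[THEN smooth_functions_outside])

lemma smooth_functions_uminus:
  "f \<in> smooth_functions M \<Longrightarrow> (\<lambda>p. - f p) \<in> smooth_functions M"
  using smooth_functions_cmult[of f "-1"] by simp

text \<open>Constants are cut off outside the manifold because members of
  \<open>smooth_functions M\<close> vanish there.\<close>

lemma smooth_functions_const:
  "(\<lambda>p. if p \<in> topspace (mtop M) then c else 0) \<in> smooth_functions M"
proof (rule smooth_functionsI)
  fix U \<phi> k assume "(U, \<phi>) \<in> atlas M" "open (\<phi> ` U)"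
  then show "Ck_on UNIV k (\<phi> ` U) (\<lambda>x. if inv_into U \<phi> x \<in> topspace (mtop M) then c else 0)"
    by (intro Ck_on_cong[OF _ _ Ck_on_const[of _ _ c]])
       (use chart_subset in \<open>force+\<close>)
qed simp

lemma smooth_functions_zero [simp]: "(\<lambda>p. 0) \<in> smooth_functions M"
  using smooth_functions_const[of 0] by simp

lemma smooth_functions_sum:
  "(\<And>i. i \<in> I \<Longrightarrow> f i \<in> smooth_functions M) \<Longrightarrow> (\<lambda>p. \<Sum>i\<in>I. f i p) \<in> smooth_functions M"
  by (induction I rule: infinite_finite_induct) (simp_all add: smooth_functions_add)

text \<open>Extension by zero. The open sets \<open>N\<close> and the complement of \<open>C\<close>
  cover the manifold: on \<open>N\<close>, smoothness in the chart \<open>\<phi>\<close> is carried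
  to any other chart by the transition map; off \<open>C\<close> the function is zero.\<close>

lemma smooth_functions_extend:
  assumes UNIV: "model M = UNIV" and U: "(U, \<phi>) \<in> atlas M"
    and N: "openin (mtop M) N" "N \<subseteq> U" and C: "closedin (mtop M) C" "C \<subseteq> N"
    and F: "\<And>k. Ck_on UNIV k (\<phi> ` N) (\<lambda>x. F (inv_into U \<phi> x))" "\<And>q. q \<notin> C \<Longrightarrow> F q = 0"
  shows "F \<in> smooth_functions M"
proof (rule smooth_functionsI)
  fix p assume "p \<notin> topspace (mtop M)"
  then show "F p = 0"
    using C closedin_subset F(2) by blast
next
  fix W \<psi> k assume W: "(W, \<psi>) \<in> atlas M"
  note Wo = chart_open[OF W]
  show "Ck_on UNIV k (\<psi> ` W) (\<lambda>x. F (inv_into W \<psi> x))"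
  proof (rule Ck_on_local)
    fix x assume "x \<in> \<psi> ` W"
    then obtain q where q: "q \<in> W" "x = \<psi> q" by blast
    show "\<exists>T. open T \<and> x \<in> T \<and> Ck_on UNIV k T (\<lambda>x. F (inv_into W \<psi> x))"
    proof (cases "q \<in> N")
      case True
      have o: "open (\<psi> ` (W \<inter> N))"
        by (rule chart_open_image[OF UNIV W]) (use Wo N in auto)
      have "Ck_on UNIV k (\<psi> ` (W \<inter> U)) (\<lambda>x. \<phi> (inv_into W \<psi> x))"
        using chart_transition[OF W U] UNIV by (simp add: smooth_on_def o_def)
      then have "Ck_on UNIV k (\<psi> ` (W \<inter> N)) (\<lambda>x. \<phi> (inv_into W \<psi> x))"
        by (rule Ck_on_subset) (use N in auto)
      then have "Ck_on UNIV k (\<psi> ` (W \<inter> N)) (\<lambda>x. F (inv_into U \<phi> (\<phi> (inv_into W \<psi> x))))"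
        by (rule Ck_on_compose[OF o chart_open_image[OF UNIV U N] _ F(1), rotated]) (use W in auto)
      then have "Ck_on UNIV k (\<psi> ` (W \<inter> N)) (\<lambda>x. F (inv_into W \<psi> x))"
        by (rule Ck_on_cong[OF o, rotated]) (use W U N in auto)
      then show ?thesis
        using o q True by blast
    next
      case False
      have o: "open (\<psi> ` (W - C))"
        by (rule chart_open_image[OF UNIV W]) (use Wo C in auto)
      have "Ck_on UNIV k (\<psi> ` (W - C)) (\<lambda>x. F (inv_into W \<psi> x))"
        by (rule Ck_on_cong[OF o _ Ck_on_const[OF o, of _ 0]]) (use W F(2) in auto)
      then show ?thesis
        using o q C False by blast
    qed
  qed
qed

section \<open>Tangent vectors and vector fields\<close>

lemma tangent_add:
  "v \<in> tangent_space M p \<Longrightarrow> f \<in> smooth_functions M \<Longrightarrow> g \<in> smooth_functions M \<Longrightarrow>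
    v (\<lambda>q. f q + g q) = v f + v g"
  by (simp add: tangent_space_def plus_fun_def)

lemma tangent_mult:
  "v \<in> tangent_space M p \<Longrightarrow> f \<in> smooth_functions M \<Longrightarrow> g \<in> smooth_functions M \<Longrightarrow>
    v (\<lambda>q. f q * g q) = v f * g p + f p * v g"
  by (simp add: tangent_space_def times_fun_def)

lemma tangent_cmult:
  "v \<in> tangent_space M p \<Longrightarrow> f \<in> smooth_functions M \<Longrightarrow> v (\<lambda>q. c * f q) = c * v f"
  by (simp add: tangent_space_def)

lemma tangent_outside: "v \<in> tangent_space M p \<Longrightarrow> f \<notin> smooth_functions M \<Longrightarrow> v f = 0"
  by (simp add: tangent_space_def)

lemma tangent_zero: "v \<in> tangent_space M p \<Longrightarrow> v (\<lambda>q. 0) = 0"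
  using tangent_cmult[of v p "\<lambda>q. 0" 0] by simp

lemma tangent_sum:
  assumes "v \<in> tangent_space M p" "\<And>i. i \<in> I \<Longrightarrow> f i \<in> smooth_functions M"
  shows "v (\<lambda>q. \<Sum>i\<in>I. f i q) = (\<Sum>i\<in>I. v (f i))"
  using assms(2)
proof (induction I rule: infinite_finite_induct)
  case (insert i I)
  then show ?case
    using tangent_add[OF assms(1), of "f i" "\<lambda>q. \<Sum>i\<in>I. f i q"] by (simp add: smooth_functions_sum)
qed (use assms(1) in \<open>simp_all add: tangent_zero\<close>)

text \<open>The unit function is idempotent, so the product rule at a point of the manifold gives
  \<open>v 1 = 2 * v 1\<close>.\<close>

lemma tangent_const:
  assumes "v \<in> tangent_space M p" "p \<in> topspace (mtop M)"
  shows "v (\<lambda>q. if q \<in> topspace (mtop M) then c else 0) = 0"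
proof -
  let ?one = "\<lambda>q. if q \<in> topspace (mtop M) then 1 else 0 :: real"
  have "(\<lambda>q. ?one q * ?one q) = ?one" by auto
  then have "v ?one = 0"
    using tangent_mult[OF assms(1) smooth_functions_const smooth_functions_const, of 1 1] assms(2) by simp
  moreover have "(\<lambda>q. if q \<in> topspace (mtop M) then c else 0) = (\<lambda>q. c * ?one q)" by auto
  ultimately show ?thesis
    using tangent_cmult[OF assms(1) smooth_functions_const, of c 1] by simp
qed

lemma tangent_space_combination:
  assumes "\<And>i. i \<in> I \<Longrightarrow> v i \<in> tangent_space M p"
  shows "(\<lambda>f. \<Sum>i\<in>I. c i * v i f) \<in> tangent_space M p"
  using assms
  by (auto simp: tangent_space_def distrib_left sum.distrib sum_distrib_right sum_distrib_left mult_ac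
      intro!: sum.cong)

lemma tangent_space_add:
  "v \<in> tangent_space M p \<Longrightarrow> w \<in> tangent_space M p \<Longrightarrow> v + w \<in> tangent_space M p"
  using tangent_space_combination[of UNIV "\<lambda>b. if b then v else w" p "\<lambda>_. 1"]
  by (simp add: UNIV_bool plus_fun_def add.commute)

lemma tangent_space_scale: "v \<in> tangent_space M p \<Longrightarrow> (\<lambda>f. c * v f) \<in> tangent_space M p"
  using tangent_space_combination[of "{()}" "\<lambda>_. v" p "\<lambda>_. c"] by simp

lemma vector_fields_tangent: "X \<in> vector_fields M \<Longrightarrow> p \<in> topspace (mtop M) \<Longrightarrow> X p \<in> tangent_space M p"
  by (simp add: vector_fields_def)

lemma vector_fields_smooth: "X \<in> vector_fields M \<Longrightarrow> f \<in> smooth_functions M \<Longrightarrow> (\<lambda>p. X p f) \<in> smooth_functions M"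
  by (simp add: vector_fields_def)

lemma vector_fields_outside: "X \<in> vector_fields M \<Longrightarrow> p \<notin> topspace (mtop M) \<Longrightarrow> X p = 0"
  by (simp add: vector_fields_def)

section \<open>Global frames around a point\<close>

text \<open>The field with components \<open>c b\<close> along the coordinate derivations of the
  chart, extended by zero. The test for smoothness of \<open>f\<close> follows the convention that
  tangent vectors vanish on all other functions.\<close>

definition coord_field :: "'m set \<Rightarrow> ('m \<Rightarrow> 'e) \<Rightarrow> ('e \<Rightarrow> 'm \<Rightarrow> real) \<Rightarrow> 'm vfield" where
  "coord_field U \<phi> c = (\<lambda>q f. if q \<in> U \<and> f \<in> smooth_functions M
     then \<Sum>b\<in>Basis. c b q * frechet_derivative (\<lambda>x. f (inv_into U \<phi> x)) (at (\<phi> q)) b else 0)"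

text \<open>The coefficients live on a closed set \<open>C\<close> inside the chart domain, so the
  field applied to a smooth function can be extended by zero; pointwise it is a derivation because
  partial derivatives are.\<close>

lemma coord_field_vector_field:
  assumes UNIV: "model M = UNIV" and U: "(U, \<phi>) \<in> atlas M"
    and C: "closedin (mtop M) C" "C \<subseteq> U"
    and c: "\<And>b. c b \<in> smooth_functions M" "\<And>b q. q \<notin> C \<Longrightarrow> c b q = 0"
  shows "coord_field U \<phi> c \<in> vector_fields M"
proof -
  let ?D = "\<lambda>f q. frechet_derivative (\<lambda>x. f (inv_into U \<phi> x)) (at (\<phi> q))"
  have o: "open (\<phi> ` U)"
    using chart_image_openin[OF U] UNIV by simp
  note D = Ck_on_SucD[OF smooth_functionsD[OF _ UNIV U]]
  have der: "((\<lambda>x. f (inv_into U \<phi> x)) has_derivative ?D f q) (at (\<phi> q))"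
    if "f \<in> smooth_functions M" "q \<in> U" for f q
    using D(1)[OF that(1)] that(2) by simp
  have add: "?D (\<lambda>q. f q + g q) q b = ?D f q b + ?D g q b"
    and mult: "?D (\<lambda>q. f q * g q) q b = f q * ?D g q b + ?D f q b * g q"
    and cmult: "?D (\<lambda>q. a * f q) q b = a * ?D f q b"
    if "f \<in> smooth_functions M" "g \<in> smooth_functions M" "q \<in> U" for f g q b a
    using frechet_derivative_at[OF has_derivative_add[OF der der], OF that(1,3) that(2,3)]
      frechet_derivative_at[OF has_derivative_mult[OF der der], OF that(1,3) that(2,3)]
      frechet_derivative_at[OF has_derivative_mult_right[OF der], OF that(1,3), of a] U that(3)
    by (simp_all add: fun_eq_iff)
  have "coord_field U \<phi> c q \<in> tangent_space M q" for q
    unfolding tangent_space_def plus_fun_def times_fun_def coord_field_def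
    by (auto simp: add mult cmult smooth_functions_add smooth_functions_mult smooth_functions_cmult
        sum.distrib sum_distrib_left sum_distrib_right algebra_simps)
  moreover have "coord_field U \<phi> c q = 0" if "q \<notin> topspace (mtop M)" for q
    using that chart_subset[OF U] by (auto simp: coord_field_def fun_eq_iff)
  moreover have "(\<lambda>q. coord_field U \<phi> c q f) \<in> smooth_functions M" if f: "f \<in> smooth_functions M" for f
  proof (rule smooth_functions_extend[OF UNIV U chart_open[OF U] subset_refl C])
    have "Ck_on UNIV k (\<phi> ` U) (\<lambda>x. \<Sum>b\<in>Basis. c b (inv_into U \<phi> x) * frechet_derivative (\<lambda>x. f (inv_into U \<phi> x)) (at x) b)" for k
      by (intro Ck_on_sum Ck_on_mult o smooth_functionsD[OF c(1) UNIV U] D(2) f)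
    then show "Ck_on UNIV k (\<phi> ` U) (\<lambda>x. coord_field U \<phi> c (inv_into U \<phi> x) f)" for k
      by (rule Ck_on_cong[OF o, rotated]) (use U f in \<open>auto simp: coord_field_def\<close>)
  qed (simp add: coord_field_def c(2))
  ultimately show ?thesis
    by (simp add: vector_fields_def)
qed

text \<open>The identity is demanded at every \<open>q\<close>, not only at \<open>p\<close>. It
  thus becomes an equality of global sections to which a module map can be applied; division by
  \<open>\<kappa> p\<close> comes afterwards.\<close>

definition frame_at :: "'m \<Rightarrow> 'e set \<Rightarrow> ('m \<Rightarrow> real) \<Rightarrow> ('e \<Rightarrow> 'm \<Rightarrow> real) \<Rightarrow> ('e \<Rightarrow> 'm vfield) \<Rightarrow> bool" where
  "frame_at p I \<kappa> x E \<longleftrightarrow> finite I \<and> \<kappa> \<in> smooth_functions M \<and> \<kappa> p \<noteq> 0 \<and>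
     (\<forall>i\<in>I. x i \<in> smooth_functions M \<and> E i \<in> vector_fields M) \<and>
     (\<forall>q\<in>topspace (mtop M). \<forall>v\<in>tangent_space M q. \<forall>f\<in>smooth_functions M.
        \<kappa> q * v f = (\<Sum>i\<in>I. v (x i) * E i q f))"

text \<open>Every function vanishing off the manifold is smooth, including the indicator of a single
  point \<open>q\<close>. The product of this indicator with \<open>f - f q\<close> is zero, and the
  product rule yields \<open>v f = 0\<close>. All tangent spaces are trivial, so the empty frame
  with \<open>\<kappa> = 1\<close> works.\<close>

lemma frame_exists_zero_dim:
  assumes "model M = {0}" "p \<in> topspace (mtop M)"
  shows "\<exists>I \<kappa> x E. frame_at p I \<kappa> x E"
proof -
  have smooth: "f \<in> smooth_functions M" if "\<And>q. q \<notin> topspace (mtop M) \<Longrightarrow> f q = 0" for f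
    by (rule smooth_functionsI) (use assms(1) that in auto)
  have "v f = 0" if q: "q \<in> topspace (mtop M)" and v: "v \<in> tangent_space M q" and f: "f \<in> smooth_functions M" for q v f
  proof -
    let ?h = "\<lambda>r. if r = q then 1 else 0 :: real" and ?c = "\<lambda>r. if r \<in> topspace (mtop M) then - f q else 0"
    have h: "?h \<in> smooth_functions M" by (rule smooth) (use q in auto)
    have fc: "(\<lambda>r. f r + ?c r) \<in> smooth_functions M" by (intro smooth_functions_add smooth_functions_const f)
    have "(\<lambda>r. (f r + ?c r) * ?h r) = (\<lambda>r. 0)" using q by auto
    then have "v (\<lambda>r. f r + ?c r) * ?h q + (f q + ?c q) * v ?h = 0"
      using tangent_mult[OF v fc h] tangent_zero[OF v] by simp
    then show ?thesis
      using q tangent_const[OF v q] tangent_add[OF v f smooth_functions_const] by simp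
  qed
  then have "frame_at p {} (\<lambda>q. if q \<in> topspace (mtop M) then 1 else 0) (\<lambda>i q. 0) (\<lambda>i. 0)"
    using assms(2) by (simp add: frame_at_def smooth_functions_const)
  then show ?thesis by blast
qed

text \<open>Hadamard's lemma at \<open>q\<close>, multiplied by the square of the bump function,
  becomes an identity between global smooth functions. A tangent vector at \<open>q\<close> can be
  applied to it without knowing that tangent vectors are local.\<close>

lemma frame_exists_pos_dim:
  assumes UNIV: "model M = UNIV" and p: "p \<in> topspace (mtop M)"
  shows "\<exists>I \<kappa> x E. frame_at p I \<kappa> x E"
proof -
  obtain U \<phi> where U: "(U, \<phi>) \<in> atlas M" and pU: "p \<in> U"
    using atlas_cover[OF p] by blast
  have o: "open (\<phi> ` U)"
    using chart_image_openin[OF U] UNIV by simp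
  then obtain R where R: "R > 0" "cball (\<phi> p) R \<subseteq> \<phi> ` U"
    using pU open_contains_cball by blast
  \<comment> \<open>Two radii: the bump function is supported in the closed ball of radius
    \<open>r\<close>, whose preimage \<open>C\<close> is closed in the manifold; the larger open
    ball of radius \<open>R\<close> supplies the neighbourhood \<open>N\<close> of \<open>C\<close>
    and a convex domain for Hadamard's lemma.\<close>
  define r where "r = R / 2"
  define C where "C = {q \<in> U. \<phi> q \<in> cball (\<phi> p) r}"
  define N where "N = {q \<in> U. \<phi> q \<in> ball (\<phi> p) R}"
  have r: "0 < r" "r < R" using R(1) by (auto simp: r_def)
  have "cball (\<phi> p) r \<subseteq> \<phi> ` U"
    using R(2) r subset_cball[of r R] by (meson less_imp_le order_trans)
  then have C: "closedin (mtop M) C" "C \<subseteq> U" "C \<subseteq> N"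
    using chart_compact_vimage[OF U compact_cball] r unfolding C_def N_def by auto
  have N: "openin (mtop M) N" "N \<subseteq> U"
    using chart_open_vimage[OF U open_ball] unfolding N_def by auto
  have N_image: "\<phi> ` N = ball (\<phi> p) R"
    using R(2) ball_subset_cball unfolding N_def by blast
  \<comment> \<open>The bump \<open>exp (- 1 / (r^2 - d^2))\<close>, with \<open>d\<close> the
    distance to \<open>\<phi> p\<close>, cut to zero for \<open>d \<ge> r\<close>. The squared
    distance is expanded in coordinates so that the closure rules for sums and products
    apply.\<close>
  define \<beta> where "\<beta> y = flat 0 (r\<^sup>2 + (-1) * (\<Sum>b\<in>Basis. ((y - \<phi> p) \<bullet> b) * ((y - \<phi> p) \<bullet> b)))" for y
  have norm: "(\<Sum>b\<in>Basis. ((y - \<phi> p) \<bullet> b) * ((y - \<phi> p) \<bullet> b)) = (dist (\<phi> p) y)\<^sup>2" for y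
    by (simp add: euclidean_inner[symmetric] dist_norm norm_minus_commute power2_norm_eq_inner)
  have \<beta>_outside: "\<beta> y = 0" if "y \<notin> cball (\<phi> p) r" for y
  proof -
    have "r\<^sup>2 \<le> (dist (\<phi> p) y)\<^sup>2"
      using that r(1) by (intro power_mono) auto
    then show ?thesis
      unfolding \<beta>_def norm by (simp add: flat_def)
  qed
  have Ck_coord: "Ck_on UNIV k S (\<lambda>y. (y - a) \<bullet> b)" if "open S" for k S and a b :: 'e
    using Ck_on_add[OF that Ck_on_linear[OF that bounded_linear_inner_left] Ck_on_const[OF that], of k b "- (a \<bullet> b)"]
    by (simp add: inner_diff_left)
  have Ck_\<beta>: "Ck_on UNIV k S \<beta>" if "open S" for k S
    unfolding \<beta>_def
    by (rule Ck_on_compose[OF that open_UNIV subset_UNIV Ck_on_flat])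
       (intro Ck_on_add Ck_on_mult Ck_on_const Ck_on_sum Ck_coord that)
  \<comment> \<open>Multiplication by the bump makes any function that is smooth on the ball alone
    into a global smooth function.\<close>
  have extend: "(\<lambda>q. if q \<in> N then \<beta> (\<phi> q) * h (\<phi> q) else 0) \<in> smooth_functions M"
    if "\<And>k. Ck_on UNIV k (ball (\<phi> p) R) h" for h
  proof (rule smooth_functions_extend[OF UNIV U N C(1,3)])
    show "Ck_on UNIV k (\<phi> ` N) (\<lambda>x. if inv_into U \<phi> x \<in> N then \<beta> (\<phi> (inv_into U \<phi> x)) * h (\<phi> (inv_into U \<phi> x)) else 0)" for k
      unfolding N_image
      by (rule Ck_on_cong[OF open_ball _ Ck_on_mult[OF open_ball Ck_\<beta>[OF open_ball] that]])
         (use U N in \<open>auto simp: N_image[symmetric] subset_iff\<close>)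
  qed (use \<beta>_outside N(2) C_def in auto)
  \<comment> \<open>The factor \<open>1\<close> here and the subtracted \<open>0\<close> in
    \<open>x\<close> present both functions as instances of \<open>extend\<close>.\<close>
  define \<psi> where "\<psi> q = (if q \<in> N then \<beta> (\<phi> q) * 1 else 0)" for q
  define x where "x b q = (if q \<in> N then \<beta> (\<phi> q) * ((\<phi> q - 0) \<bullet> b) else 0)" for b q
  have \<psi>: "\<psi> \<in> smooth_functions M"
    unfolding \<psi>_def by (intro extend Ck_on_const open_ball)
  have x: "x b \<in> smooth_functions M" for b
    unfolding x_def by (intro extend Ck_coord open_ball)
  have \<psi>_outside: "\<psi> q = 0" "x b q = 0" if "q \<notin> C" for q b
    using that \<beta>_outside[of "\<phi> q"] N(2) by (auto simp: \<psi>_def x_def C_def)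
  have x_eq: "x b q = \<psi> q * (\<phi> q \<bullet> b)" for b q
    by (simp add: x_def \<psi>_def)
  \<comment> \<open>The index 0 is free for the extra pair because it is not a basis vector.\<close>
  define E where "E i = coord_field U \<phi> (\<lambda>b. if i = 0 then \<lambda>q. - x b q else if b = i then \<psi> else (\<lambda>q. 0))" for i
  have E: "E i \<in> vector_fields M" for i
    unfolding E_def
    by (rule coord_field_vector_field[OF UNIV U C(1,2)]) (auto simp: x \<psi> \<psi>_outside smooth_functions_uminus)
  have "\<psi> q * \<psi> q * v f = v \<psi> * E 0 q f + (\<Sum>b\<in>Basis. v (x b) * E b q f)"
    if q: "q \<in> topspace (mtop M)" and v: "v \<in> tangent_space M q" and f: "f \<in> smooth_functions M" for q v f
  proof (cases "\<psi> q = 0")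
    case True
    \<comment> \<open>All coefficients of the fields \<open>E i\<close> are multiples of
      \<open>\<psi>\<close>, so both sides vanish where \<open>\<psi>\<close> does.\<close>
    then have "E i q f = 0" for i
      by (auto simp: E_def coord_field_def x_eq intro!: sum.neutral)
    then show ?thesis using True by simp
  next
    case False
    then have qN: "q \<in> N" and qU: "q \<in> U"
      using N(2) by (auto simp: \<psi>_def split: if_splits)
    let ?D = "\<lambda>b. frechet_derivative (\<lambda>x. f (inv_into U \<phi> x)) (at (\<phi> q)) b"
    have "smooth_on UNIV (ball (\<phi> p) R) (\<lambda>x. f (inv_into U \<phi> x))"
      unfolding smooth_on_def
      by (intro allI Ck_on_subset[OF smooth_functionsD[OF f UNIV U]]) (use R(2) in auto)
    then obtain g where g: "\<And>b. smooth_on UNIV (ball (\<phi> p) R) (g b)" "\<And>b. g b (\<phi> q) = ?D b"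
      "\<And>y. y \<in> ball (\<phi> p) R \<Longrightarrow> f (inv_into U \<phi> y) = f (inv_into U \<phi> (\<phi> q)) + (\<Sum>b\<in>Basis. ((y - \<phi> q) \<bullet> b) * g b y)"
      using Hadamard[of "ball (\<phi> p) R" "\<phi> q" "\<lambda>x. f (inv_into U \<phi> x)"] qN by (auto simp: N_def)
    define G where "G b q = (if q \<in> N then \<beta> (\<phi> q) * g b (\<phi> q) else 0)" for b q
    have G: "G b \<in> smooth_functions M" for b
      unfolding G_def by (rule extend) (use g(1) in \<open>simp add: smooth_on_def\<close>)
    \<comment> \<open>\<open>Y b\<close> is \<open>\<psi>\<close> times the coordinate difference
      between \<open>s\<close> and \<open>q\<close>; in particular it vanishes at
      \<open>q\<close>.\<close>
    define Y where "Y b s = x b s + (- (\<phi> q \<bullet> b)) * \<psi> s" for b s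
    have Y: "Y b \<in> smooth_functions M" for b
      unfolding Y_def by (intro smooth_functions_add smooth_functions_cmult x \<psi>)
    \<comment> \<open>Subtracting the value at \<open>q\<close> leaves \<open>v f\<close> unchanged
      and removes the term in which \<open>v\<close> differentiates the square of
      \<open>\<psi>\<close>.\<close>
    define h where "h s = f s + (if s \<in> topspace (mtop M) then - f q else 0)" for s
    have h: "h \<in> smooth_functions M"
      unfolding h_def by (intro smooth_functions_add smooth_functions_const f)
    have "v h = v f" "h q = 0"
      using tangent_add[OF v f smooth_functions_const] tangent_const[OF v q] q by (simp_all add: h_def[abs_def])
    then have lhs: "v (\<lambda>s. (\<psi> s * \<psi> s) * h s) = \<psi> q * \<psi> q * v f"
      using tangent_mult[OF v smooth_functions_mult[OF \<psi> \<psi>] h] by simp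
    \<comment> \<open>The globalized Hadamard identity: one factor \<open>\<psi>\<close> goes to the
      coordinate differences, the other to the coefficients \<open>g b\<close>.\<close>
    have "(\<psi> s * \<psi> s) * h s = (\<Sum>b\<in>Basis. Y b s * G b s)" for s
    proof (cases "s \<in> N")
      case True
      then have "s \<in> U" "s \<in> topspace (mtop M)" and "\<phi> s \<in> ball (\<phi> p) R"
        using N(2) chart_subset[OF U] by (auto simp: N_def)
      then have "h s = (\<Sum>b\<in>Basis. ((\<phi> s - \<phi> q) \<bullet> b) * g b (\<phi> s))"
        using g(3)[of "\<phi> s"] U qU by (simp add: h_def)
      then show ?thesis
        using True by (simp add: Y_def G_def x_eq \<psi>_def sum_distrib_left inner_diff_left algebra_simps)
    next
      case False
      then show ?thesis by (simp add: \<psi>_def G_def)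
    qed
    then have "\<psi> q * \<psi> q * v f = v (\<lambda>s. \<Sum>b\<in>Basis. Y b s * G b s)"
      using lhs by simp
    also have "\<dots> = (\<Sum>b\<in>Basis. v (\<lambda>s. Y b s * G b s))"
      by (intro tangent_sum[OF v] smooth_functions_mult Y G)
    \<comment> \<open>Only one term of the product rule survives since
      \<open>Y b q = 0\<close>.\<close>
    also have "\<dots> = (\<Sum>b\<in>Basis. v (Y b) * G b q)"
      by (simp add: tangent_mult[OF v Y G]) (simp add: Y_def x_eq)
    also have "\<dots> = (\<Sum>b\<in>Basis. (v (x b) - (\<phi> q \<bullet> b) * v \<psi>) * (\<psi> q * ?D b))"
    proof -
      have "v (Y b) = v (x b) - (\<phi> q \<bullet> b) * v \<psi>" for b
        using tangent_add[OF v x smooth_functions_cmult[OF \<psi>], of b "- (\<phi> q \<bullet> b)"]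
          tangent_cmult[OF v \<psi>, of "- (\<phi> q \<bullet> b)"] by (simp add: Y_def[abs_def])
      moreover have "G b q = \<psi> q * ?D b" for b
        using qN by (simp add: G_def g(2) \<psi>_def)
      ultimately show ?thesis by simp
    qed
    \<comment> \<open>The terms containing \<open>v \<psi>\<close> add up to the extra field
      \<open>E 0\<close>, whose coefficients are \<open>- x b\<close>.\<close>
    also have "\<dots> = v \<psi> * E 0 q f + (\<Sum>b\<in>Basis. v (x b) * E b q f)"
    proof -
      have "E 0 q f = (\<Sum>b\<in>Basis. - (\<psi> q * (\<phi> q \<bullet> b)) * ?D b)"
        using qU f by (simp add: E_def coord_field_def x_eq)
      moreover have "E b q f = \<psi> q * ?D b" if "b \<in> Basis" for b
      proof -
        have "b \<noteq> 0"
          using that nonzero_Basis by blast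
        then have "E b q f = (\<Sum>b'\<in>Basis. (if b' = b then \<psi> else (\<lambda>q. 0)) q * ?D b')"
          unfolding E_def coord_field_def using qU f by simp
        also have "\<dots> = (\<Sum>b'\<in>Basis. if b' = b then \<psi> q * ?D b else 0)"
          by (intro sum.cong) auto
        finally show ?thesis using that by simp
      qed
      ultimately show ?thesis
        by (simp add: sum_distrib_left sum.distrib[symmetric] algebra_simps)
    qed
    finally show ?thesis .
  qed
  moreover have "\<psi> p \<noteq> 0"
    using pU r R(1) by (simp add: \<psi>_def N_def \<beta>_def flat_def)
  ultimately have "frame_at p (insert 0 Basis) (\<lambda>q. \<psi> q * \<psi> q) (\<lambda>i. if i = 0 then \<psi> else x i) E"
    using \<psi> x E by (auto simp: frame_at_def smooth_functions_mult intro!: sum.cong)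
  then show ?thesis by blast
qed

lemma frame_exists: "p \<in> topspace (mtop M) \<Longrightarrow> \<exists>I \<kappa> x E. frame_at p I \<kappa> x E"
  using model_cases frame_exists_pos_dim frame_exists_zero_dim by blast

section \<open>Duality of vector fields and 1-forms\<close>

lemma cotangent_combination:
  assumes a: "a \<in> cotangent_space M p" and v: "\<And>i. i \<in> I \<Longrightarrow> v i \<in> tangent_space M p"
  shows "a (\<lambda>f. \<Sum>i\<in>I. c i * v i f) = (\<Sum>i\<in>I. c i * a (v i))"
proof -
  have scale: "a (\<lambda>f. c * w f) = c * a w" if "w \<in> tangent_space M p" for c w
    using a that by (simp add: cotangent_space_def)
  have add: "a (\<lambda>f. w f + z f) = a w + a z" if "w \<in> tangent_space M p" "z \<in> tangent_space M p" for w z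
    using a that by (simp add: cotangent_space_def plus_fun_def)
  have zero: "a (\<lambda>f. 0) = 0"
    using scale[of "\<lambda>f. 0" 0] tangent_space_combination[of "{}"] by simp
  from v show ?thesis
  proof (induction I rule: infinite_finite_induct)
    case (insert i I)
    have "(\<lambda>f. c i * v i f) \<in> tangent_space M p"
      using insert.prems by (intro tangent_space_scale) simp
    then show ?case
      using insert add[OF _ tangent_space_combination[of I v p c], of "\<lambda>f. c i * v i f"] by (simp add: scale)
  qed (simp_all add: zero)
qed

text \<open>Both sides also vanish on functions that are not smooth, so the frame identity is an
  equality of total functions, which a covector can take as its argument.\<close>

lemma frame_vector:
  assumes "frame_at p I \<kappa> x E" "q \<in> topspace (mtop M)" "v \<in> tangent_space M q"
  shows "\<kappa> q * v f = (\<Sum>i\<in>I. v (x i) * E i q f)"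
proof (cases "f \<in> smooth_functions M")
  case True
  then show ?thesis using assms by (simp add: frame_at_def)
next
  case False
  have "E i q f = 0" if "i \<in> I" for i
    using assms(1,2) that False tangent_outside[OF vector_fields_tangent] by (auto simp: frame_at_def)
  then show ?thesis
    using tangent_outside[OF assms(3) False] by simp
qed

lemma frame_covector:
  assumes "frame_at p I \<kappa> x E" "q \<in> topspace (mtop M)" "v \<in> tangent_space M q" "a \<in> cotangent_space M q"
  shows "\<kappa> q * a v = (\<Sum>i\<in>I. v (x i) * a (E i q))"
proof -
  have "\<kappa> q * a v = a (\<lambda>f. \<kappa> q * v f)"
    using assms(3,4) by (simp add: cotangent_space_def)
  also have "\<dots> = a (\<lambda>f. \<Sum>i\<in>I. v (x i) * E i q f)"
    by (simp add: frame_vector[OF assms(1-3)])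
  also have "\<dots> = (\<Sum>i\<in>I. v (x i) * a (E i q))"
    by (rule cotangent_combination[OF assms(4)])
       (use assms(1,2) in \<open>auto simp: frame_at_def vector_fields_tangent\<close>)
  finally show ?thesis .
qed

section \<open>Module structure and the pairing\<close>

lemma one_forms_cotangent: "\<xi> \<in> one_forms M \<Longrightarrow> p \<in> topspace (mtop M) \<Longrightarrow> \<xi> p \<in> cotangent_space M p"
  by (simp add: one_forms_def)

lemma one_forms_outside: "\<xi> \<in> one_forms M \<Longrightarrow> p \<notin> topspace (mtop M) \<Longrightarrow> \<xi> p = 0"
  by (simp add: one_forms_def)

lemma pairing_smooth: "\<xi> \<in> one_forms M \<Longrightarrow> X \<in> vector_fields M \<Longrightarrow> pairing \<xi> X \<in> smooth_functions M"
  by (simp add: one_forms_def)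

lemma pairing_add_left: "pairing (\<xi> + \<eta>) X = pairing \<xi> X + pairing \<eta> X"
  by (simp add: pairing_def fun_eq_iff)

lemma pairing_uminus_left: "pairing (- \<xi>) X = - pairing \<xi> X"
  by (simp add: pairing_def fun_eq_iff)

lemma pairing_diff_left: "pairing (\<xi> - \<eta>) X = pairing \<xi> X - pairing \<eta> X"
  by (simp add: pairing_def fun_eq_iff)

lemma pairing_zero_left: "pairing 0 X = 0"
  by (simp add: pairing_def fun_eq_iff)

lemma pairing_fscale_left: "pairing (fscale f \<xi>) X = f * pairing \<xi> X"
  by (simp add: pairing_def fscale_def fun_eq_iff)

lemma pairing_add_right:
  assumes "\<xi> \<in> one_forms M" "X \<in> vector_fields M" "Y \<in> vector_fields M"
  shows "pairing \<xi> (X + Y) = pairing \<xi> X + pairing \<xi> Y"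
proof
  fix p
  show "pairing \<xi> (X + Y) p = (pairing \<xi> X + pairing \<xi> Y) p"
    using one_forms_cotangent[OF assms(1), of p] one_forms_outside[OF assms(1), of p]
      vector_fields_tangent[OF assms(2), of p] vector_fields_tangent[OF assms(3), of p]
    by (cases "p \<in> topspace (mtop M)") (auto simp: pairing_def cotangent_space_def)
qed

lemma pairing_fscale_right:
  assumes "\<xi> \<in> one_forms M" "X \<in> vector_fields M"
  shows "pairing \<xi> (fscale f X) = f * pairing \<xi> X"
proof
  fix p
  show "pairing \<xi> (fscale f X) p = (f * pairing \<xi> X) p"
    using one_forms_cotangent[OF assms(1), of p] one_forms_outside[OF assms(1), of p]
      vector_fields_tangent[OF assms(2), of p]
    by (cases "p \<in> topspace (mtop M)") (auto simp: pairing_def fscale_def cotangent_space_def)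
qed

lemma vector_fields_add:
  assumes "X \<in> vector_fields M" "Y \<in> vector_fields M"
  shows "X + Y \<in> vector_fields M"
proof -
  have "X p + Y p \<in> tangent_space M p" if "p \<in> topspace (mtop M)" for p
    using assms that by (intro tangent_space_add vector_fields_tangent)
  then show ?thesis
    using assms smooth_functions_add by (simp add: vector_fields_def)
qed

lemma vector_fields_fscale:
  assumes "g \<in> smooth_functions M" "X \<in> vector_fields M"
  shows "fscale g X \<in> vector_fields M"
proof -
  have "fscale g X p \<in> tangent_space M p" if "p \<in> topspace (mtop M)" for p
    unfolding fscale_def using assms that by (intro tangent_space_scale vector_fields_tangent)
  then show ?thesis
    using assms smooth_functions_mult[OF assms(1)] by (simp add: vector_fields_def fscale_def fun_eq_iff)
qed

lemma vector_fields_zero: "0 \<in> vector_fields M"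
  using tangent_space_combination[of "{}"] smooth_functions_zero
  by (simp add: vector_fields_def zero_fun_def)

lemma one_forms_add:
  assumes "\<xi> \<in> one_forms M" "\<eta> \<in> one_forms M"
  shows "\<xi> + \<eta> \<in> one_forms M"
proof -
  have "pairing (\<xi> + \<eta>) X \<in> smooth_functions M" if "X \<in> vector_fields M" for X
    using smooth_functions_plus[OF pairing_smooth pairing_smooth] assms that
    by (simp add: pairing_add_left)
  then show ?thesis
    using assms by (simp add: one_forms_def cotangent_space_def algebra_simps)
qed

lemma one_forms_fscale:
  assumes "g \<in> smooth_functions M" "\<xi> \<in> one_forms M"
  shows "fscale g \<xi> \<in> one_forms M"
proof -
  have "pairing (fscale g \<xi>) X \<in> smooth_functions M" if "X \<in> vector_fields M" for X
    using smooth_functions_times[OF assms(1) pairing_smooth] assms that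
    by (simp add: pairing_fscale_left)
  moreover have "fscale g \<xi> p \<in> cotangent_space M p" if "p \<in> topspace (mtop M)" for p
    using one_forms_cotangent[OF assms(2) that]
    by (simp add: fscale_def cotangent_space_def algebra_simps)
  moreover have "fscale g \<xi> p = 0" if "p \<notin> topspace (mtop M)" for p
    using one_forms_outside[OF assms(2) that] by (simp add: fscale_def fun_eq_iff)
  ultimately show ?thesis
    by (simp add: one_forms_def)
qed

lemma one_forms_zero: "0 \<in> one_forms M"
  using smooth_functions_zero
  by (simp add: one_forms_def cotangent_space_def pairing_zero_left) (simp add: zero_fun_def)

lemma pairing_zero_right: "\<xi> \<in> one_forms M \<Longrightarrow> pairing \<xi> 0 = 0"
  using pairing_fscale_right[OF _ vector_fields_zero, of \<xi> 0]
  by (simp add: fscale_def zero_fun_def times_fun_def)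

lemma one_forms_uminus: "\<xi> \<in> one_forms M \<Longrightarrow> - \<xi> \<in> one_forms M"
  using smooth_functions_uminus[OF pairing_smooth]
  by (simp add: one_forms_def pairing_uminus_left cotangent_space_def) (simp add: fun_Compl_def)

text \<open>There are enough global fields: by \<open>frame_covector\<close>,
  \<open>\<kappa> p * \<xi> p v\<close> depends on \<open>\<xi>\<close> only through its pairings
  with the \<open>E i\<close>.\<close>

lemma one_forms_eqI:
  assumes "\<xi> \<in> one_forms M" "\<eta> \<in> one_forms M"
    and eq: "\<And>X. X \<in> vector_fields M \<Longrightarrow> pairing \<xi> X = pairing \<eta> X"
  shows "\<xi> = \<eta>"
proof (intro ext)
  fix p v
  show "\<xi> p v = \<eta> p v"
  proof (cases "p \<in> topspace (mtop M) \<and> v \<in> tangent_space M p")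
    case True
    then obtain I \<kappa> x E where fr: "frame_at p I \<kappa> x E"
      using frame_exists by blast
    have "\<kappa> p * \<xi> p v = (\<Sum>i\<in>I. v (x i) * pairing \<xi> (E i) p)"
      unfolding pairing_def
      by (rule frame_covector[OF fr]) (use True assms(1) in \<open>auto simp: one_forms_cotangent\<close>)
    also have "\<dots> = (\<Sum>i\<in>I. v (x i) * pairing \<eta> (E i) p)"
      using fr eq by (simp add: frame_at_def)
    also have "\<dots> = \<kappa> p * \<eta> p v"
      unfolding pairing_def
      by (rule frame_covector[OF fr, symmetric]) (use True assms(2) in \<open>auto simp: one_forms_cotangent\<close>)
    finally show ?thesis
      using fr by (simp add: frame_at_def)
  next
    case False
    then show ?thesis
      using assms(1,2)
      by (cases "p \<in> topspace (mtop M)") (auto simp: one_forms_def cotangent_space_def)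
  qed
qed

section \<open>Differentials and the representation of linear functionals\<close>

definition differential :: "('m \<Rightarrow> real) \<Rightarrow> 'm form1" where
  "differential f = (\<lambda>p v. if p \<in> topspace (mtop M) \<and> v \<in> tangent_space M p then v f else 0)"

lemma pairing_differential: "X \<in> vector_fields M \<Longrightarrow> pairing (differential f) X = (\<lambda>p. X p f)"
  by (auto simp: pairing_def differential_def vector_fields_def fun_eq_iff)

lemma differential_one_form:
  assumes "f \<in> smooth_functions M"
  shows "differential f \<in> one_forms M"
proof -
  have "differential f p \<in> cotangent_space M p" for p
    by (auto simp: differential_def cotangent_space_def tangent_space_add tangent_space_scale)
  then show ?thesis
    using assms
    by (auto simp: one_forms_def pairing_differential vector_fields_smooth)
       (simp add: differential_def fun_eq_iff)
qed

text \<open>The last rule turns a real factor into a smooth function, since module maps respect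
  scaling by smooth functions.\<close>

lemma differential_rules:
  assumes "f \<in> smooth_functions M" "g \<in> smooth_functions M"
  shows "differential (f + g) = differential f + differential g"
    and "differential (f * g) = fscale g (differential f) + fscale f (differential g)"
    and "differential (\<lambda>q. c * f q) = fscale (\<lambda>p. if p \<in> topspace (mtop M) then c else 0) (differential f)"
  using assms
  by (auto simp: differential_def fun_eq_iff fscale_def tangent_space_def)

text \<open>Differentials suffice as test forms: pairing \<open>differential f\<close> with
  \<open>X\<close> recovers the action of \<open>X\<close> on \<open>f\<close>.\<close>

lemma vector_fields_eqI:
  assumes "X \<in> vector_fields M" "Y \<in> vector_fields M"
    and eq: "\<And>\<xi>. \<xi> \<in> one_forms M \<Longrightarrow> pairing \<xi> X = pairing \<xi> Y"
  shows "X = Y"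
proof (intro ext)
  fix p f
  show "X p f = Y p f"
  proof (cases "f \<in> smooth_functions M \<and> p \<in> topspace (mtop M)")
    case True
    then show ?thesis
      using eq[OF differential_one_form, of f] assms(1,2) by (simp add: pairing_differential fun_eq_iff)
  next
    case False
    then show ?thesis
      using assms(1,2)
      by (cases "p \<in> topspace (mtop M)") (auto simp: vector_fields_def tangent_space_def)
  qed
qed

text \<open>The induction also carries membership of the partial sums in \<open>A\<close>, because
  additivity of \<open>a\<close> is known only there.\<close>

lemma module_map_combination:
  fixes a :: "('m \<Rightarrow> 'b \<Rightarrow> real) \<Rightarrow> 'm \<Rightarrow> real"
  assumes a: "module_map (smooth_functions M) fscale A (*) (smooth_functions M) a"
    and A: "\<And>x y. x \<in> A \<Longrightarrow> y \<in> A \<Longrightarrow> x + y \<in> A"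
      "\<And>g x. g \<in> smooth_functions M \<Longrightarrow> x \<in> A \<Longrightarrow> fscale g x \<in> A" "0 \<in> A"
    and gE: "\<And>i. i \<in> I \<Longrightarrow> g i \<in> smooth_functions M" "\<And>i. i \<in> I \<Longrightarrow> E i \<in> A"
  shows "a (\<lambda>p z. \<Sum>i\<in>I. g i p * E i p z) = (\<lambda>p. \<Sum>i\<in>I. g i p * a (E i) p)"
proof -
  have "a (fscale (\<lambda>p. 0) 0) = (\<lambda>p. 0) * a 0"
    using a A(3) smooth_functions_zero unfolding module_map_def by blast
  then have zero: "a (\<lambda>p z. 0) = (\<lambda>p. 0)"
    by (simp add: fscale_def times_fun_def)
  have "(\<lambda>p z. \<Sum>i\<in>I. g i p * E i p z) \<in> A \<and> a (\<lambda>p z. \<Sum>i\<in>I. g i p * E i p z) = (\<lambda>p. \<Sum>i\<in>I. g i p * a (E i) p)"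
    using gE
  proof (induction I rule: infinite_finite_induct)
    case (insert i I)
    let ?S = "\<lambda>p z. \<Sum>i\<in>I. g i p * E i p z"
    have S: "?S \<in> A" "a ?S = (\<lambda>p. \<Sum>i\<in>I. g i p * a (E i) p)"
      using insert by auto
    have i: "g i \<in> smooth_functions M" "E i \<in> A" "fscale (g i) (E i) \<in> A"
      using insert.prems A(2) by auto
    have "a (fscale (g i) (E i) + ?S) = g i * a (E i) + a ?S"
      using a i S(1) by (simp add: module_map_def)
    moreover have "fscale (g i) (E i) + ?S = (\<lambda>p z. \<Sum>i\<in>insert i I. g i p * E i p z)"
      using insert.hyps by (simp add: fscale_def fun_eq_iff)
    moreover have "g i * a (E i) + a ?S = (\<lambda>p. \<Sum>i\<in>insert i I. g i p * a (E i) p)"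
      using insert.hyps S(2) by (simp add: fun_eq_iff)
    ultimately show ?case
      using A(1)[OF i(3) S(1)] by simp
  qed (use A(3) zero in \<open>simp_all add: zero_fun_def\<close>)
  then show ?thesis by blast
qed

text \<open>Tensoriality: applying \<open>a\<close> to the global identity for
  \<open>fscale \<kappa> X\<close> and dividing by \<open>\<kappa> p\<close> shows that
  \<open>a X p\<close> is a linear expression in \<open>X p\<close> alone. That expression, with a
  frame chosen for each \<open>p\<close>, is the covector at \<open>p\<close>.\<close>

lemma one_form_of_module_map:
  assumes a: "module_map (smooth_functions M) fscale (vector_fields M) (*) (smooth_functions M) a"
  shows "\<exists>\<zeta>\<in>one_forms M. \<forall>X\<in>vector_fields M. pairing \<zeta> X = a X"
proof -
  have smooth: "a X \<in> smooth_functions M" if "X \<in> vector_fields M" for X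
    using a that by (simp add: module_map_def)
  have "\<exists>I x e. \<forall>X\<in>vector_fields M. a X p = (\<Sum>i\<in>(I :: 'e set). X p (x i) * e i)"
    if p: "p \<in> topspace (mtop M)" for p
  proof -
    obtain I \<kappa> x E where fr: "frame_at p I \<kappa> x E"
      using frame_exists[OF p] by blast
    have "a X p = (\<Sum>i\<in>I. X p (x i) * (a (E i) p / \<kappa> p))" if X: "X \<in> vector_fields M" for X
    proof -
      have "fscale \<kappa> X = (\<lambda>q f. \<Sum>i\<in>I. X q (x i) * E i q f)"
      proof (intro ext)
        fix q f
        show "fscale \<kappa> X q f = (\<Sum>i\<in>I. X q (x i) * E i q f)"
          using frame_vector[OF fr _ vector_fields_tangent[OF X], of q f] vector_fields_outside[OF X, of q]
          by (cases "q \<in> topspace (mtop M)") (simp_all add: fscale_def)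
      qed
      then have "a (fscale \<kappa> X) = (\<lambda>q. \<Sum>i\<in>I. X q (x i) * a (E i) q)"
        using module_map_combination[OF a vector_fields_add vector_fields_fscale vector_fields_zero, of I "\<lambda>i q. X q (x i)" E]
          fr vector_fields_smooth[OF X] by (simp add: frame_at_def)
      moreover have "a (fscale \<kappa> X) = \<kappa> * a X"
        using a fr X by (simp add: module_map_def frame_at_def)
      ultimately have "\<kappa> p * a X p = (\<Sum>i\<in>I. X p (x i) * a (E i) p)"
        by (metis times_fun_apply)
      moreover have "\<kappa> p \<noteq> 0"
        using fr by (simp add: frame_at_def)
      ultimately show ?thesis
        by (simp add: sum_divide_distrib[symmetric] field_simps)
    qed
    then show ?thesis by (intro exI ballI)
  qed
  then obtain I x e where rep: "\<And>p X. p \<in> topspace (mtop M) \<Longrightarrow> X \<in> vector_fields M \<Longrightarrow>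
      a X p = (\<Sum>i\<in>(I p :: 'e set). X p (x p i) * e p i)"
    by metis
  define \<zeta> where "\<zeta> p v = (if p \<in> topspace (mtop M) \<and> v \<in> tangent_space M p
      then \<Sum>i\<in>I p. v (x p i) * e p i else 0)" for p v
  have pair: "pairing \<zeta> X = a X" if "X \<in> vector_fields M" for X
    using that rep[OF _ that] smooth_functions_outside[OF smooth[OF that]] vector_fields_tangent[OF that]
    by (auto simp: pairing_def \<zeta>_def)
  have "\<zeta> p \<in> cotangent_space M p" for p
    by (auto simp: \<zeta>_def cotangent_space_def tangent_space_add tangent_space_scale sum.distrib algebra_simps sum_distrib_left)
  moreover have "\<zeta> p = 0" if "p \<notin> topspace (mtop M)" for p
    using that by (simp add: \<zeta>_def fun_eq_iff)
  \<comment> \<open>The frames are chosen independently at different points. Smoothness of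
    \<open>\<zeta>\<close> still holds because it concerns only the pairings with fields, and these
    are the smooth functions \<open>a X\<close>.\<close>
  ultimately have "\<zeta> \<in> one_forms M"
    using pair smooth by (simp add: one_forms_def)
  then show ?thesis
    using pair by blast
qed

text \<open>Applying \<open>b\<close> to differentials gives a derivation, by the product rule for
  differentials. That the resulting field represents \<open>b\<close> on all forms follows from the
  expansion of \<open>fscale \<kappa> \<xi>\<close> in the differentials of the
  \<open>x i\<close>.\<close>

lemma vector_field_of_module_map:
  assumes b: "module_map (smooth_functions M) fscale (one_forms M) (*) (smooth_functions M) b"
  shows "\<exists>Z\<in>vector_fields M. \<forall>\<xi>\<in>one_forms M. pairing \<xi> Z = b \<xi>"
proof -
  have smooth: "b \<xi> \<in> smooth_functions M"
    and add: "\<eta> \<in> one_forms M \<Longrightarrow> b (\<xi> + \<eta>) = b \<xi> + b \<eta>"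
    and scale: "f \<in> smooth_functions M \<Longrightarrow> b (fscale f \<xi>) = f * b \<xi>" if "\<xi> \<in> one_forms M" for \<xi> \<eta> f
    using b that by (simp_all add: module_map_def)
  define Z where "Z p f = (if p \<in> topspace (mtop M) \<and> f \<in> smooth_functions M then b (differential f) p else 0)" for p f
  have Zt: "Z p \<in> tangent_space M p" if "p \<in> topspace (mtop M)" for p
    unfolding tangent_space_def
  proof (intro CollectI conjI ballI allI impI)
    fix f g assume fg: "f \<in> smooth_functions M" "g \<in> smooth_functions M"
    note d = fg[THEN differential_one_form]
    show "Z p (f + g) = Z p f + Z p g"
      using fg that smooth_functions_plus[OF fg]
      by (simp add: Z_def differential_rules add d)
    show "Z p (f * g) = Z p f * g p + f p * Z p g"
      using fg that smooth_functions_times[OF fg]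
      by (simp add: Z_def differential_rules add scale one_forms_fscale d)
  next
    fix c f assume f: "f \<in> smooth_functions M"
    show "Z p (\<lambda>q. c * f q) = c * Z p f"
      using f that smooth_functions_cmult[OF f, of c]
      by (simp add: Z_def differential_rules[OF f f] scale differential_one_form smooth_functions_const)
  qed (simp add: Z_def)
  have "(\<lambda>p. Z p f) = b (differential f)" if "f \<in> smooth_functions M" for f
    using that smooth_functions_outside[OF smooth[OF differential_one_form[OF that]]]
    by (auto simp: Z_def)
  then have Z: "Z \<in> vector_fields M"
    using Zt smooth differential_one_form by (auto simp: vector_fields_def Z_def fun_eq_iff)
  have "pairing \<xi> Z p = b \<xi> p" if \<xi>: "\<xi> \<in> one_forms M" for \<xi> p
  proof (cases "p \<in> topspace (mtop M)")
    case True
    then obtain I \<kappa> x E where fr: "frame_at p I \<kappa> x E"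
      using frame_exists by blast
    have "fscale \<kappa> \<xi> = (\<lambda>q v. \<Sum>i\<in>I. pairing \<xi> (E i) q * differential (x i) q v)"
    proof (intro ext)
      fix q v
      show "fscale \<kappa> \<xi> q v = (\<Sum>i\<in>I. pairing \<xi> (E i) q * differential (x i) q v)"
      proof (cases "q \<in> topspace (mtop M) \<and> v \<in> tangent_space M q")
        case True
        then show ?thesis
          using frame_covector[OF fr _ _ one_forms_cotangent[OF \<xi>], of q v]
          by (simp add: fscale_def pairing_def differential_def mult.commute)
      next
        case False
        then have "\<xi> q v = 0"
          using \<xi> by (auto simp: one_forms_def cotangent_space_def)
        then show ?thesis
          using False by (auto simp: fscale_def differential_def)
      qed
    qed
    then have "b (fscale \<kappa> \<xi>) = (\<lambda>q. \<Sum>i\<in>I. pairing \<xi> (E i) q * b (differential (x i)) q)"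
      using module_map_combination[OF b one_forms_add one_forms_fscale one_forms_zero, of I "\<lambda>i. pairing \<xi> (E i)" "\<lambda>i. differential (x i)"]
        fr by (simp add: frame_at_def pairing_smooth[OF \<xi>] differential_one_form)
    moreover have "b (fscale \<kappa> \<xi>) = \<kappa> * b \<xi>"
      using fr \<xi> by (simp add: scale frame_at_def)
    ultimately have "\<kappa> p * b \<xi> p = (\<Sum>i\<in>I. pairing \<xi> (E i) p * b (differential (x i)) p)"
      by (metis times_fun_apply)
    also have "\<dots> = (\<Sum>i\<in>I. Z p (x i) * \<xi> p (E i p))"
      using fr True by (simp add: Z_def frame_at_def pairing_def mult.commute)
    \<comment> \<open>The frame identity is read backwards, at the tangent vector
      \<open>Z p\<close>.\<close>
    also have "\<dots> = \<kappa> p * \<xi> p (Z p)"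
      using frame_covector[OF fr True Zt[OF True] one_forms_cotangent[OF \<xi> True]] by simp
    finally show ?thesis
      using fr by (simp add: frame_at_def pairing_def)
  next
    case False
    then show ?thesis
      using one_forms_outside[OF \<xi>] smooth_functions_outside[OF smooth[OF \<xi>]] by (simp add: pairing_def)
  qed
  then show ?thesis
    using Z by (auto simp: fun_eq_iff)
qed

text \<open>Justifies the definite description: existence is the representation of
  \<open>\<lambda>X. pairing \<xi> (H X)\<close> by a form, uniqueness is
  \<open>one_forms_eqI\<close>.\<close>

lemma dual_map_spec:
  assumes H: "module_map (smooth_functions M) fscale (vector_fields M) fscale (vector_fields M) H"
    and \<xi>: "\<xi> \<in> one_forms M"
  shows "dual_map M H \<xi> \<in> one_forms M"
    and "X \<in> vector_fields M \<Longrightarrow> pairing (dual_map M H \<xi>) X = pairing \<xi> (H X)"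
proof -
  have "module_map (smooth_functions M) fscale (vector_fields M) (*) (smooth_functions M) (\<lambda>X. pairing \<xi> (H X))"
    using H \<xi> by (simp add: module_map_def pairing_smooth pairing_add_right pairing_fscale_right)
  then have "\<exists>!\<zeta>. \<zeta> \<in> one_forms M \<and> (\<forall>X\<in>vector_fields M. pairing \<zeta> X = pairing \<xi> (H X))"
    using one_form_of_module_map one_forms_eqI by (metis (no_types, lifting))
  from theI'[OF this]
  show "dual_map M H \<xi> \<in> one_forms M"
    and "X \<in> vector_fields M \<Longrightarrow> pairing (dual_map M H \<xi>) X = pairing \<xi> (H X)"
    unfolding dual_map_def by blast+
qed

lemma dual_map_eqI:
  assumes "\<zeta> \<in> one_forms M" "\<And>X. X \<in> vector_fields M \<Longrightarrow> pairing \<zeta> X = pairing \<xi> (H X)"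
  shows "dual_map M H \<xi> = \<zeta>"
  unfolding dual_map_def using assms one_forms_eqI by (intro the_equality) auto

section \<open>Generalized symplectic structures\<close>

lemma gen_sections_closed:
  "u \<in> gen_sections M \<Longrightarrow> v \<in> gen_sections M \<Longrightarrow> u + v \<in> gen_sections M"
  "f \<in> smooth_functions M \<Longrightarrow> u \<in> gen_sections M \<Longrightarrow> gscale f u \<in> gen_sections M"
  "0 \<in> gen_sections M"
  by (auto simp: gen_sections_def vector_fields_add one_forms_add gscale_def
      vector_fields_fscale one_forms_fscale zero_prod_def vector_fields_zero one_forms_zero)

lemma nat_gen_metric_eq:
  "nat_gen_metric u v p = (pairing (snd u) (fst v) p + pairing (snd v) (fst u) p) / 2"
  by (simp add: nat_gen_metric_def)

lemma nat_gen_metric_commute: "nat_gen_metric u v = nat_gen_metric v u"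
  by (simp add: nat_gen_metric_def add.commute)

lemma nat_gen_metric_module_map:
  assumes "u \<in> gen_sections M"
  shows "module_map (smooth_functions M) gscale (gen_sections M) (*) (smooth_functions M) (nat_gen_metric u)"
  unfolding module_map_def
proof (intro conjI ballI)
  fix v assume v: "v \<in> gen_sections M"
  show "nat_gen_metric u v \<in> smooth_functions M"
    unfolding nat_gen_metric_def using assms v
    by (intro smooth_functions_cmult smooth_functions_add pairing_smooth)
       (auto simp: gen_sections_def)
  show "nat_gen_metric u (v + w) = nat_gen_metric u v + nat_gen_metric u w" if "w \<in> gen_sections M" for w
    using assms v that
    by (auto simp: fun_eq_iff nat_gen_metric_eq gen_sections_def pairing_add_left pairing_add_right field_simps)
  show "nat_gen_metric u (gscale f v) = f * nat_gen_metric u v" if "f \<in> smooth_functions M" for f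
    using assms v that
    by (auto simp: fun_eq_iff nat_gen_metric_eq gen_sections_def gscale_def pairing_fscale_left
        pairing_fscale_right field_simps)
qed

text \<open>Nondegeneracy of the natural metric: test sections \<open>(0, \<xi>)\<close> detect the
  vector part and \<open>(X, 0)\<close> the form part.\<close>

lemma nat_gen_metric_eqI:
  assumes u: "u \<in> gen_sections M" "w \<in> gen_sections M"
    and eq: "\<And>v. v \<in> gen_sections M \<Longrightarrow> nat_gen_metric u v = nat_gen_metric w v"
  shows "u = w"
proof (rule prod_eqI)
  show "fst u = fst w"
  proof (rule vector_fields_eqI)
    fix \<xi> assume "\<xi> \<in> one_forms M"
    then show "pairing \<xi> (fst u) = pairing \<xi> (fst w)"
      using eq[of "(0, \<xi>)"] u
      by (auto simp: fun_eq_iff nat_gen_metric_eq gen_sections_def vector_fields_zero pairing_zero_right)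
  qed (use u in \<open>auto simp: gen_sections_def\<close>)
  show "snd u = snd w"
  proof (rule one_forms_eqI)
    fix X assume "X \<in> vector_fields M"
    then show "pairing (snd u) X = pairing (snd w) X"
      using eq[of "(X, 0)"]
      by (auto simp: fun_eq_iff nat_gen_metric_eq gen_sections_def one_forms_zero pairing_zero_left)
  qed (use u in \<open>auto simp: gen_sections_def\<close>)
qed

text \<open>The two dualities are applied to the restrictions of \<open>a\<close> to the summands.
  The roles cross: the restriction to vector fields gives the form part of \<open>w\<close>, the
  restriction to forms its vector part. The factor 2 cancels the one half in the metric.\<close>

lemma nat_gen_metric_represents:
  assumes a: "module_map (smooth_functions M) gscale (gen_sections M) (*) (smooth_functions M) a"
  shows "\<exists>w\<in>gen_sections M. \<forall>v\<in>gen_sections M. a v = nat_gen_metric w v"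
proof -
  have smooth: "a v \<in> smooth_functions M"
    and add: "w \<in> gen_sections M \<Longrightarrow> a (v + w) = a v + a w"
    and scale: "f \<in> smooth_functions M \<Longrightarrow> a (gscale f v) = f * a v" if "v \<in> gen_sections M" for v w f
    using a that by (simp_all add: module_map_def)
  have X: "(X, 0) \<in> gen_sections M" if "X \<in> vector_fields M" for X
    using that by (simp add: gen_sections_def one_forms_zero)
  have \<xi>: "(0, \<xi>) \<in> gen_sections M" if "\<xi> \<in> one_forms M" for \<xi>
    using that by (simp add: gen_sections_def vector_fields_zero)
  have "module_map (smooth_functions M) fscale (vector_fields M) (*) (smooth_functions M) (\<lambda>X p. 2 * a (X, 0) p)"
    unfolding module_map_def
  proof (intro conjI ballI)
    fix X assume XV: "X \<in> vector_fields M"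
    show "(\<lambda>p. 2 * a (X, 0) p) \<in> smooth_functions M"
      by (intro smooth_functions_cmult smooth X XV)
    show "(\<lambda>p. 2 * a (X + Y, 0) p) = (\<lambda>p. 2 * a (X, 0) p) + (\<lambda>p. 2 * a (Y, 0) p)" if "Y \<in> vector_fields M" for Y
      using add[OF X[OF XV] X[OF that]] by (simp add: fun_eq_iff)
    show "(\<lambda>p. 2 * a (fscale f X, 0) p) = f * (\<lambda>p. 2 * a (X, 0) p)" if "f \<in> smooth_functions M" for f
      using scale[OF X[OF XV] that] by (simp add: fun_eq_iff gscale_def fscale_def zero_fun_def)
  qed
  then obtain \<zeta> where \<zeta>: "\<zeta> \<in> one_forms M" "\<And>X. X \<in> vector_fields M \<Longrightarrow> pairing \<zeta> X = (\<lambda>p. 2 * a (X, 0) p)"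
    using one_form_of_module_map by blast
  have "module_map (smooth_functions M) fscale (one_forms M) (*) (smooth_functions M) (\<lambda>\<xi> p. 2 * a (0, \<xi>) p)"
    unfolding module_map_def
  proof (intro conjI ballI)
    fix \<eta> assume \<eta>: "\<eta> \<in> one_forms M"
    show "(\<lambda>p. 2 * a (0, \<eta>) p) \<in> smooth_functions M"
      by (intro smooth_functions_cmult smooth \<xi> \<eta>)
    show "(\<lambda>p. 2 * a (0, \<eta> + \<theta>) p) = (\<lambda>p. 2 * a (0, \<eta>) p) + (\<lambda>p. 2 * a (0, \<theta>) p)" if "\<theta> \<in> one_forms M" for \<theta>
      using add[OF \<xi>[OF \<eta>] \<xi>[OF that]] by (simp add: fun_eq_iff)
    show "(\<lambda>p. 2 * a (0, fscale f \<eta>) p) = f * (\<lambda>p. 2 * a (0, \<eta>) p)" if "f \<in> smooth_functions M" for f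
      using scale[OF \<xi>[OF \<eta>] that] by (simp add: fun_eq_iff gscale_def fscale_def zero_fun_def)
  qed
  then obtain Z where Z: "Z \<in> vector_fields M" "\<And>\<eta>. \<eta> \<in> one_forms M \<Longrightarrow> pairing \<eta> Z = (\<lambda>p. 2 * a (0, \<eta>) p)"
    using vector_field_of_module_map by blast
  have "a v = nat_gen_metric (Z, \<zeta>) v" if v: "v \<in> gen_sections M" for v
  proof -
    obtain Y \<eta> where [simp]: "v = (Y, \<eta>)" and Y\<eta>: "Y \<in> vector_fields M" "\<eta> \<in> one_forms M"
      using v by (auto simp: gen_sections_def)
    have "a v = a (Y, 0) + a (0, \<eta>)"
      using add[OF X \<xi>] Y\<eta> by simp
    then show ?thesis
      using Y\<eta> \<zeta>(2) Z(2) by (simp add: fun_eq_iff nat_gen_metric_eq)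
  qed
  then show ?thesis
    using \<zeta>(1) Z(1) by (intro bexI[of _ "(Z, \<zeta>)"]) (auto simp: gen_sections_def)
qed

text \<open>\<open>K u\<close> represents \<open>\<Omega> u\<close>. Nondegeneracy of the metric
  makes \<open>K\<close> linear, nondegeneracy of \<open>\<Omega>\<close> makes it injective, and
  skew-symmetry of \<open>\<Omega>\<close> on pairs of summands gives the conditions on the
  blocks.\<close>

lemma gen_symplectic_imp_endo:
  assumes \<Omega>: "gen_symplectic M \<Omega>"
  shows "\<exists>K. gen_endo M K \<and> inj_on K (gen_sections M) \<and>
    (\<forall>u\<in>gen_sections M. \<forall>v\<in>gen_sections M. \<Omega> u v = nat_gen_metric (K u) v) \<and> skew_block_form M K"
proof -
  let ?\<Gamma> = "gen_sections M"
  note P = \<Omega>[unfolded gen_symplectic_def]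
  note right = bspec[OF conjunct1[OF P]]
    and left = bspec[OF conjunct1[OF conjunct2[OF P]]]
    and skew = bspec[OF bspec[OF conjunct1[OF conjunct2[OF conjunct2[OF P]]]]]
  have nondeg: "u = 0" if "u \<in> ?\<Gamma>" "\<And>v. v \<in> ?\<Gamma> \<Longrightarrow> \<Omega> u v = 0" for u
    using conjunct2[OF conjunct2[OF conjunct2[OF P]]] that by simp
  have "\<forall>u\<in>?\<Gamma>. \<exists>w\<in>?\<Gamma>. \<forall>v\<in>?\<Gamma>. \<Omega> u v = nat_gen_metric w v"
    using nat_gen_metric_represents[OF right] by simp
  then obtain K where K: "\<And>u. u \<in> ?\<Gamma> \<Longrightarrow> K u \<in> ?\<Gamma>"
    and \<Omega>K: "\<And>u v. u \<in> ?\<Gamma> \<Longrightarrow> v \<in> ?\<Gamma> \<Longrightarrow> \<Omega> u v = nat_gen_metric (K u) v"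
    by metis
  have smooth: "\<Omega> u v \<in> smooth_functions M"
    and add: "w \<in> ?\<Gamma> \<Longrightarrow> \<Omega> (u + w) v = \<Omega> u v + \<Omega> w v"
    and scale: "f \<in> smooth_functions M \<Longrightarrow> \<Omega> (gscale f u) v = f * \<Omega> u v"
    if "u \<in> ?\<Gamma>" "v \<in> ?\<Gamma>" for u v w f
    using left that by (simp_all add: module_map_def)
  have madd: "nat_gen_metric (u + w) v = nat_gen_metric u v + nat_gen_metric w v"
    and mscale: "f \<in> smooth_functions M \<Longrightarrow> nat_gen_metric (gscale f u) v = f * nat_gen_metric u v"
    if "u \<in> ?\<Gamma>" "v \<in> ?\<Gamma>" "w \<in> ?\<Gamma>" for u v w f
    using nat_gen_metric_module_map[OF that(2)] that
    by (simp_all add: module_map_def nat_gen_metric_commute[of _ v])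
  have K_add: "K (u + w) = K u + K w" if "u \<in> ?\<Gamma>" "w \<in> ?\<Gamma>" for u w
    using that
    by (intro nat_gen_metric_eqI) (simp_all add: K gen_sections_closed \<Omega>K[symmetric] madd add)
  have K_scale: "K (gscale f u) = gscale f (K u)" if "f \<in> smooth_functions M" "u \<in> ?\<Gamma>" for f u
    using that
    by (intro nat_gen_metric_eqI)
       (simp_all add: K gen_sections_closed \<Omega>K[symmetric] mscale[OF K _ K] scale)
  have endo: "gen_endo M K"
    by (simp add: gen_endo_def module_map_def K K_add K_scale)
  have inj: "inj_on K ?\<Gamma>"
  proof (rule inj_onI)
    fix u w assume uw: "u \<in> ?\<Gamma>" "w \<in> ?\<Gamma>" "K u = K w"
    \<comment> \<open>The difference of \<open>u\<close> and \<open>w\<close> is expressed through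
      scaling by the smooth function -1, so that linearity of \<open>\<Omega>\<close> in its first
      argument applies.\<close>
    let ?m = "\<lambda>p. if p \<in> topspace (mtop M) then - 1 else 0 :: real"
    have m: "?m \<in> smooth_functions M"
      by (rule smooth_functions_const)
    have "\<Omega> (u + gscale ?m w) v = 0" if v: "v \<in> ?\<Gamma>" for v
    proof
      fix p
      show "\<Omega> (u + gscale ?m w) v p = 0 p"
        using uw m v smooth_functions_outside[OF smooth[OF uw(2) v], of p]
        by (simp add: add scale gen_sections_closed) (simp add: \<Omega>K)
    qed
    then have "u + gscale ?m w = 0"
      by (intro nondeg) (simp_all add: uw m gen_sections_closed)
    moreover have "gscale ?m w = - w"
    proof -
      have "fscale ?m (fst w) = - fst w" "fscale ?m (snd w) = - snd w"
        using uw(2) by (auto simp: fscale_def fun_eq_iff gen_sections_def vector_fields_def one_forms_def)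
      then show ?thesis by (simp add: gscale_def prod_eq_iff)
    qed
    ultimately show "u = w" by simp
  qed
  define H where "H X = fst (K (X, 0))" for X
  define \<tau> where "\<tau> X = snd (K (X, 0))" for X
  define \<sigma> where "\<sigma> \<xi> = fst (K (0, \<xi>))" for \<xi>
  have X: "(X, 0) \<in> ?\<Gamma>" if "X \<in> vector_fields M" for X
    using that by (simp add: gen_sections_def one_forms_zero)
  have \<xi>: "(0, \<xi>) \<in> ?\<Gamma>" if "\<xi> \<in> one_forms M" for \<xi>
    using that by (simp add: gen_sections_def vector_fields_zero)
  have fst_K: "fst (K u) \<in> vector_fields M" and snd_K: "snd (K u) \<in> one_forms M" if "u \<in> ?\<Gamma>" for u
    using K[OF that] by (auto simp: gen_sections_def)
  have scale0: "(fscale f X, 0) = gscale f (X, 0)" "(0, fscale f \<eta>) = gscale f (0, \<eta>)" for f X \<eta>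
    by (simp_all add: gscale_def fscale_def zero_fun_def)
  have add0: "(X + Y, 0 :: 'm form1) = (X, 0) + (Y, 0)" "(0 :: 'm vfield, \<eta> + \<theta>) = (0, \<eta>) + (0, \<theta>)" for X Y :: "'m vfield" and \<eta> \<theta> :: "'m form1"
    by simp_all
  have "module_map (smooth_functions M) fscale (vector_fields M) fscale (vector_fields M) H"
    and "module_map (smooth_functions M) fscale (one_forms M) fscale (vector_fields M) \<sigma>"
    and "module_map (smooth_functions M) fscale (vector_fields M) fscale (one_forms M) \<tau>"
    unfolding module_map_def H_def \<sigma>_def \<tau>_def scale0 add0
    by (simp_all add: X \<xi> fst_K snd_K K_add K_scale del: add_Pair) (simp_all add: gscale_def)
  moreover have pair_XX: "pairing (\<tau> X) Y p = 2 * \<Omega> (X, 0) (Y, 0) p"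
    if "X \<in> vector_fields M" "Y \<in> vector_fields M" for X Y p
    using that by (simp add: \<Omega>K X nat_gen_metric_eq \<tau>_def pairing_zero_left)
  have "pairing (\<tau> X) Y = - pairing (\<tau> Y) X" if "X \<in> vector_fields M" "Y \<in> vector_fields M" for X Y
    using that skew[OF X X, of X Y] by (simp add: fun_eq_iff pair_XX)
  moreover have pair_\<xi>\<xi>: "pairing \<eta> (\<sigma> \<theta>) p = 2 * \<Omega> (0, \<theta>) (0, \<eta>) p"
    if "\<theta> \<in> one_forms M" "\<eta> \<in> one_forms M" for \<theta> \<eta> p
    using that by (simp add: \<Omega>K \<xi> nat_gen_metric_eq \<sigma>_def pairing_zero_right snd_K)
  have "pairing \<eta> (\<sigma> \<theta>) = - pairing \<theta> (\<sigma> \<eta>)" if "\<theta> \<in> one_forms M" "\<eta> \<in> one_forms M" for \<theta> \<eta>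
    using that skew[OF \<xi> \<xi>, of \<theta> \<eta>] by (simp add: fun_eq_iff pair_\<xi>\<xi>)
  moreover have "K u = block_map H \<sigma> \<tau> (\<lambda>\<xi>. - dual_map M H \<xi>) u" if u: "u \<in> ?\<Gamma>" for u
  proof -
    obtain Y \<eta> where u_eq: "u = (Y, 0) + (0, \<eta>)" and Y: "Y \<in> vector_fields M" and \<eta>: "\<eta> \<in> one_forms M"
      using u by (auto simp: gen_sections_def)
    \<comment> \<open>The lower right block and \<open>H\<close> are read off from the values of
      \<open>\<Omega>\<close> on mixed pairs in opposite order; skew-symmetry produces the minus
      sign.\<close>
    have "dual_map M H \<eta> = - snd (K (0, \<eta>))"
    proof (rule dual_map_eqI)
      show "- snd (K (0, \<eta>)) \<in> one_forms M"
        by (intro one_forms_uminus snd_K \<xi> \<eta>)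
      fix W assume W: "W \<in> vector_fields M"
      have "pairing (snd (K (0, \<eta>))) W p = 2 * \<Omega> (0, \<eta>) (W, 0) p" for p
        using W \<eta> by (simp add: \<Omega>K X \<xi> nat_gen_metric_eq pairing_zero_left)
      moreover have "pairing \<eta> (H W) p = 2 * \<Omega> (W, 0) (0, \<eta>) p" for p
        using W \<eta> by (simp add: \<Omega>K X \<xi> nat_gen_metric_eq pairing_zero_right snd_K H_def)
      ultimately show "pairing (- snd (K (0, \<eta>))) W = pairing \<eta> (H W)"
        using skew[OF \<xi>[OF \<eta>] X[OF W]] by (simp add: fun_eq_iff pairing_uminus_left)
    qed
    moreover have "K u = K (Y, 0) + K (0, \<eta>)"
      unfolding u_eq by (rule K_add[OF X[OF Y] \<xi>[OF \<eta>]])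
    ultimately show ?thesis
      by (simp add: u_eq block_map_def H_def \<sigma>_def \<tau>_def prod_eq_iff)
  qed
  ultimately have "skew_block_form M K"
    unfolding skew_block_form_def by blast
  then show ?thesis
    using endo inj \<Omega>K by blast
qed

text \<open>In the metric applied to \<open>K u\<close> and \<open>v\<close>, the terms with
  \<open>\<tau>\<close> and \<open>\<sigma>\<close> are skew by hypothesis, and those with
  \<open>H\<close> and its dual combine to
  \<open>pairing \<eta> (H X) - pairing \<xi> (H Y)\<close>, which changes sign under exchange. For
  nondegeneracy, \<open>K u\<close> orthogonal to everything gives \<open>K u = 0 = K 0\<close>, and
  injectivity gives \<open>u = 0\<close>.\<close>

lemma endo_imp_gen_symplectic:
  assumes endo: "gen_endo M K" and inj: "inj_on K (gen_sections M)" and "skew_block_form M K"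
  shows "gen_symplectic M (\<lambda>u v. nat_gen_metric (K u) v)"
proof -
  let ?\<Gamma> = "gen_sections M"
  obtain H \<sigma> \<tau> where H: "module_map (smooth_functions M) fscale (vector_fields M) fscale (vector_fields M) H"
    and \<sigma>: "module_map (smooth_functions M) fscale (one_forms M) fscale (vector_fields M) \<sigma>"
    and \<tau>: "module_map (smooth_functions M) fscale (vector_fields M) fscale (one_forms M) \<tau>"
    and \<tau>_skew: "\<And>X Y. X \<in> vector_fields M \<Longrightarrow> Y \<in> vector_fields M \<Longrightarrow> pairing (\<tau> X) Y = - pairing (\<tau> Y) X"
    and \<sigma>_skew: "\<And>\<xi> \<eta>. \<xi> \<in> one_forms M \<Longrightarrow> \<eta> \<in> one_forms M \<Longrightarrow> pairing \<xi> (\<sigma> \<eta>) = - pairing \<eta> (\<sigma> \<xi>)"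
    and block: "\<And>u. u \<in> ?\<Gamma> \<Longrightarrow> K u = block_map H \<sigma> \<tau> (\<lambda>\<xi>. - dual_map M H \<xi>) u"
    using assms(3) unfolding skew_block_form_def by blast
  have K: "K u \<in> ?\<Gamma>" and K_add: "w \<in> ?\<Gamma> \<Longrightarrow> K (u + w) = K u + K w"
    and K_scale: "f \<in> smooth_functions M \<Longrightarrow> K (gscale f u) = gscale f (K u)" if "u \<in> ?\<Gamma>" for u w f
    using endo that by (simp_all add: gen_endo_def module_map_def)
  have right: "module_map (smooth_functions M) gscale ?\<Gamma> (*) (smooth_functions M) (\<lambda>v. nat_gen_metric (K u) v)"
    if "u \<in> ?\<Gamma>" for u
    using nat_gen_metric_module_map[OF K[OF that]] .
  have left: "module_map (smooth_functions M) gscale ?\<Gamma> (*) (smooth_functions M) (\<lambda>u. nat_gen_metric (K u) v)"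
    if "v \<in> ?\<Gamma>" for v
    using nat_gen_metric_module_map[OF that]
    by (simp add: module_map_def nat_gen_metric_commute[of _ v] K K_add K_scale)
  have skew: "nat_gen_metric (K u) v = - nat_gen_metric (K v) u" if uv: "u \<in> ?\<Gamma>" "v \<in> ?\<Gamma>" for u v
  proof -
    obtain X \<xi> Y \<eta> where [simp]: "u = (X, \<xi>)" "v = (Y, \<eta>)"
      and m: "X \<in> vector_fields M" "Y \<in> vector_fields M" "\<xi> \<in> one_forms M" "\<eta> \<in> one_forms M"
      using uv by (auto simp: gen_sections_def)
    have HX: "H X \<in> vector_fields M" "H Y \<in> vector_fields M" "\<sigma> \<xi> \<in> vector_fields M" "\<sigma> \<eta> \<in> vector_fields M"
      using H \<sigma> m by (auto simp: module_map_def)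
    show ?thesis
      unfolding block[OF uv(1)] block[OF uv(2)]
      using m HX \<tau>_skew[OF m(1,2)] \<sigma>_skew[OF m(3,4)]
      by (simp add: fun_eq_iff nat_gen_metric_eq block_map_def
          pairing_diff_left pairing_add_right dual_map_spec(2)[OF H] field_simps)
  qed
  have nondeg: "u = 0" if u: "u \<in> ?\<Gamma>" and z: "\<forall>v\<in>?\<Gamma>. nat_gen_metric (K u) v = 0" for u
  proof -
    have "nat_gen_metric 0 v = 0" if "v \<in> ?\<Gamma>" for v
      using that by (auto simp: fun_eq_iff nat_gen_metric_eq gen_sections_def pairing_zero_left pairing_zero_right)
    then have "K u = 0"
      using z by (intro nat_gen_metric_eqI) (simp_all add: K u gen_sections_closed)
    moreover have "K 0 = 0"
      using K_add[OF gen_sections_closed(3) gen_sections_closed(3)] by simp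
    ultimately show ?thesis
      using inj u gen_sections_closed(3) by (metis inj_onD)
  qed
  show ?thesis
    unfolding gen_symplectic_def using left right skew nondeg by blast
qed

end

theorem proposition3p2:
  fixes M :: "('m, 'e::euclidean_space) manifold"
  assumes "smooth_manifold M"
  shows "(\<forall>\<Omega>. gen_symplectic M \<Omega> \<longrightarrow>
            (\<exists>K. gen_endo M K \<and> inj_on K (gen_sections M) \<and>
                 (\<forall>u\<in>gen_sections M. \<forall>v\<in>gen_sections M. \<Omega> u v = nat_gen_metric (K u) v) \<and>
                 skew_block_form M K)) \<and>
         (\<forall>K. gen_endo M K \<and> inj_on K (gen_sections M) \<and> skew_block_form M K \<longrightarrow>
            gen_symplectic M (\<lambda>u v. nat_gen_metric (K u) v))"
  using gen_symplectic_imp_endo[OF assms] endo_imp_gen_symplectic[OF assms] by blast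

end
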